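(* Let $q\in\mathbb{D}\setminus\mathbb{R}_-$, where $\mathbb{D}$ is the open unit disk in $\mathbb{C}$ and $\mathbb{R}_-=(-\infty,0]$, and let $d\ge 0$ be an integer. Then the $q$-multigamma function $G_q^{(d)}(z)$ is an entire function of $z$ given by $$G_q^{(d)}(z+1)=\left(\prod_{i=0}^d\Big((q;q)_\infty^{(i)}\Big)^{(-1)^{i+1}\binom{z}{d-i}}\right)\cdot\Big((q^{z+1};q)_\infty^{(d)}\Big)^{(-1)^{d}},$$ where $(a;q)_\infty^{(i)}$ are the $q$-multifactorials and $\binom{z}{n}$ are the Stirling polynomials. In particular, for the quantum gamma function $\Gamma_q:=G_q^{(1)}$ and the quantum Barnes function $G_q:=G_q^{(2)}$ (the cases $d=1,2$), $$\Gamma_q(z+1)=\frac{1}{\Big((q;q)_\infty^{(0)}\Big)^{z}}\,(q;q)_\infty^{(1)}\,\frac1{(q^{z+1};q)_\infty^{(1)}},$$ $$G_q(z+1)=\frac{1}{\Big((q;q)_\infty^{(0)}\Big)^{\frac{z(z-1)}2}}\,\Big((q;q)_\infty^{(1)}\Big)^{z}\,\frac{1}{(q;q)_\infty^{(2)}}\,(q^{z+1};q)_\infty^{(2)}.$$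
   Context: **$q$-multifactorials.** For $|q|<1$, $a\in\mathbb{C}$: $(a;q)_\infty^{(0)}:=1-a$, and for integers $d\ge1$, $(a;q)_\infty^{(d)}:=\prod_{i_1,\dots,i_d=0}^\infty(1-aq^{i_1+\cdots+i_d})$. In particular $(q;q)_\infty^{(0)}=1-q$, and $(q;q)_\infty^{(1)}=(q;q)_\infty$ is the usual $q$-shifted factorial. **Stirling polynomials.** $\binom{z}{0}:=1$ and $\binom{z}{n}:=\frac{z(z-1)\cdots(z-n+1)}{n!}$ for integers $n\ge1$, $z\in\mathbb{C}$. **$q$-multigamma functions.** $(G_q^{(d)})_{d\ge0}$ is the unique hierarchy of meromorphic functions of $z$ satisfying (i) $G_q^{(d)}(1)=1$ and $G_q^{(0)}(z)=\frac{1-q^z}{1-q}$; (ii) $G_q^{(d)}(z+1)=G_q^{(d-1)}(z)\,G_q^{(d)}(z)$ for $d\ge1$; (iii) $\frac{d^{d+1}}{dx^{d+1}}\ln G_q^{(d)}(x)\ge0$ for $x\ge0$, $0<q<1$. Condition (iii) is only required for real positive $q$; the functions $G_q^{(d)}$ are continued analytically to other values of $q$. **Powers.** $q^z:=e^{z\ln q}$ with the principal branch of the logarithm. Complex powers of $(q;q)_\infty^{(i)}$ are taken factor by factor in the defining product, using principal logarithms of the factors.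
   Formalization: "Entire" fails for odd d (Γ_q has a pole at z=0): proved instead is meromorphic for all d, entire for even d, reciprocal entire for odd d. Formulas read 1/0 as 0 at poles. Condition (iii) is taken for x>0 with G positive there, as ln G is undefined at x=0. *)

theory Defs
  imports "HOL-Complex_Analysis.Complex_Analysis"
begin

(* Products over an arbitrary index set, as limits along the finite subsets
   (the multiplicative analogue of infsum). *)
definition unordered_prod :: "('i \<Rightarrow> complex) \<Rightarrow> 'i set \<Rightarrow> complex" where
  "unordered_prod f A = Lim (finite_subsets_at_top A) (\<lambda>F. \<Prod>x\<in>F. f x)"

(* A multi-index (i_1, ..., i_d) of natural numbers is a list of length d. For d = 0 the only
   multi-index is the empty list, so that the value is 1 - a; see q_multifactorial_0 below. *)
definition q_multifactorial :: "complex \<Rightarrow> complex \<Rightarrow> nat \<Rightarrow> complex" where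
  "q_multifactorial a q d = unordered_prod (\<lambda>is. 1 - a * q ^ sum_list is) {is. length is = d}"

(* The complex power with exponent w of q_multifactorial a q d, taken factor by factor with
   principal logarithms. *)
definition q_multifactorial_powr :: "complex \<Rightarrow> complex \<Rightarrow> nat \<Rightarrow> complex \<Rightarrow> complex" where
  "q_multifactorial_powr a q d w =
     unordered_prod (\<lambda>is. (1 - a * q ^ sum_list is) powr w) {is. length is = d}"

lemma unordered_prod_singleton: "unordered_prod f {x} = f x"
  unfolding unordered_prod_def
  by (auto intro!: tendsto_Lim tendsto_eventually
        simp: finite_subsets_at_top_finite principal_eq_bot_iff eventually_principal)

lemma q_multifactorial_0: "q_multifactorial a q 0 = 1 - a"
  by (simp add: q_multifactorial_def unordered_prod_singleton)

lemma q_multifactorial_powr_0: "q_multifactorial_powr a q 0 w = (1 - a) powr w"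
  by (simp add: q_multifactorial_powr_def unordered_prod_singleton)

(* The defining properties for 0 < q < 1. Meromorphic functions are normalised by the value 0
   at their poles, and the functional equation is an identity of meromorphic functions, i.e. it
   holds outside a discrete closed set. The logarithm in the last condition is that of a positive
   real function on the positive half-axis; at x = 0 each G d has a zero or a pole. *)
definition q_multigamma_hierarchy :: "real \<Rightarrow> (nat \<Rightarrow> complex \<Rightarrow> complex) \<Rightarrow> bool" where
  "q_multigamma_hierarchy q G \<longleftrightarrow>
     (\<forall>d. G d nicely_meromorphic_on UNIV) \<and>
     (\<forall>d. G d 1 = 1) \<and>
     (\<forall>z. G 0 z = (1 - of_real q powr z) / (1 - of_real q)) \<and>
     (\<forall>d\<ge>1. \<forall>\<^sub>\<approx>z\<in>UNIV. G d (z + 1) = G (d - 1) z * G d z) \<and>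
     (\<forall>d. \<forall>x::real. x > 0 \<longrightarrow>
        G d (of_real x) \<in> \<real> \<and> Re (G d (of_real x)) > 0 \<and>
        (deriv ^^ (d + 1)) (\<lambda>t::real. ln (Re (G d (of_real t)))) x \<ge> 0)"

definition q_multigamma_real :: "real \<Rightarrow> nat \<Rightarrow> complex \<Rightarrow> complex" where
  "q_multigamma_real q = (THE G. q_multigamma_hierarchy q G)"

(* For each fixed z, the analytic continuation in q from (0,1) to the slit unit disk. The poles
   in z move with q, so the continuation for fixed z is in general only meromorphic in q; it is
   again normalised by the value 0 at poles. *)
definition q_multigamma :: "complex \<Rightarrow> nat \<Rightarrow> complex \<Rightarrow> complex" where
  "q_multigamma q d z =
     (THE w. \<exists>f. f nicely_meromorphic_on (ball 0 1 - \<real>\<^sub>\<le>\<^sub>0) \<and>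
        (\<forall>x::real. 0 < x \<and> x < 1 \<longrightarrow> f (of_real x) = q_multigamma_real x d z) \<and>
        f q = w)"

definition quantum_gamma :: "complex \<Rightarrow> complex \<Rightarrow> complex" where
  "quantum_gamma q = q_multigamma q 1"

definition quantum_Barnes :: "complex \<Rightarrow> complex \<Rightarrow> complex" where
  "quantum_Barnes q = q_multigamma q 2"

end

theory Submission
  imports Defs
begin

text \<open>
  Write \<open>E d a\<close> for the multifactorial \<open>(a;q)\<^sup>(\<^sup>d\<^sup>)\<close>. Off finitely many factors it is the exponential of
  an absolutely convergent sum of principal logarithms, so it is holomorphic in all parameters, and
  the complex power of \<open>E i q\<close> with exponent \<open>w\<close> is \<open>exp (w * L i)\<close> with \<open>L i\<close> the sum of the
  logarithms of the factors. The theorem asserts that \<open>G d\<close> is the function \<open>multigamma_product\<close>,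
  
    \<open>P d z = exp (\<Sum>i\<le>d. (-1)^(i+1) * binom (z-1) (d-i) * L i) * (E d (q^z))^((-1)^d)\<close>.
  
  For real \<open>q\<close> in (0,1), \<open>P\<close> satisfies the defining properties (\<open>multigamma_product_hierarchy\<close>). The
  functional equation combines Pascal's rule in the exponent with
  \<open>E (d+1) a = E d a * E (d+1) (a q)\<close>, which comes from sorting the multi-indices by whether the
  first entry vanishes. For the sign condition, expanding the logarithms and summing the geometric
  series over the multi-indices gives
  
    \<open>ln (E d (q^x)) = - (\<Sum>k\<ge>1. q^(k x) / (k * (1 - q^k)^d))\<close>.
  
  The remaining part of \<open>ln (P d x)\<close> is a polynomial of degree at most \<open>d\<close> in \<open>x\<close>, so the derivative
  of order \<open>d+1\<close> is \<open>\<Sum>k\<ge>1. (k * \<bar>ln q\<bar>)^(d+1) * q^(k x) / (k * (1 - q^k)^d)\<close>. This is nonnegative,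
  and it tends to 0 as \<open>x\<close> tends to infinity.
  
  The decay yields uniqueness, as in the theorem of Bohr and Mollerup
  (\<open>q_multigamma_hierarchy_unique\<close>). If \<open>G\<close> is another solution that agrees with \<open>P\<close> at level \<open>d-1\<close>,
  then \<open>f = ln (G d) - ln (P d)\<close> is 1-periodic on the positive half-axis. Its derivative of order
  \<open>d+1\<close> takes the same value at \<open>x\<close> and at \<open>x+k\<close>, where it is bounded below by minus a quantity that
  vanishes as \<open>k\<close> grows; so it is nonnegative. A smooth periodic function that has a derivative of
  constant sign is constant, and \<open>f\<close> vanishes at 1. The identity theorem extends the equality of
  \<open>G d\<close> and \<open>P d\<close> to the complex plane.
  
  Finally, for fixed \<open>z\<close> the function \<open>P d z\<close> is meromorphic in \<open>q\<close> on the slit disc, which is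
  connected. Hence it is the continuation from (0,1) that defines \<open>G d z\<close> for complex \<open>q\<close>.
\<close>

section \<open>Unordered infinite products and sums of logarithms\<close>

text \<open>
  The sum over the multi-indices is the \<open>d\<close>-fold product of the geometric series. This is the only
  place where the number of multi-indices of a given weight enters.
\<close>
lemma has_sum_geometric_multi_index:
  fixes r :: real
  assumes "0 \<le> r" "r < 1"
  shows "((\<lambda>is. r ^ sum_list is) has_sum (1 / (1 - r) ^ d)) {is. length is = d}"
proof (induction d)
  case 0
  show ?case
    using has_sum_finite[of "{[]}" "\<lambda>is. r ^ sum_list is"] by simp
next
  case (Suc d)
  have geo: "((\<lambda>n. r ^ n) has_sum (1 / (1 - r))) UNIV"
    using assms by (intro sums_nonneg_imp_has_sum geometric_sums) auto
  have inner: "((\<lambda>is. r ^ n * r ^ sum_list is) has_sum r ^ n * (1 / (1 - r) ^ d)) {is. length is = d}" for n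
    by (intro has_sum_cmult_right Suc)
  have outer: "((\<lambda>n. r ^ n * (1 / (1 - r) ^ d)) has_sum (1 / (1 - r) * (1 / (1 - r) ^ d))) UNIV"
    by (intro has_sum_cmult_left geo)
  have "((\<lambda>(n, is). r ^ n * r ^ sum_list is) has_sum (1 / (1 - r) * (1 / (1 - r) ^ d)))
          (UNIV \<times> {is. length is = d})"
  proof (rule has_sum_SigmaI)
    show "(\<lambda>(n, is). r ^ n * r ^ sum_list is) summable_on UNIV \<times> {is. length is = d}"
      using assms inner outer
      by (intro summable_on_SigmaI[where g = "\<lambda>n. r ^ n * (1 / (1 - r) ^ d)"])
         (auto simp: summable_on_def)
  qed (use inner outer in auto)
  also have "?this \<longleftrightarrow> ?case"
    by (intro has_sum_reindex_bij_witness[of _ "\<lambda>is. (hd is, tl is)" "\<lambda>(n, is). n # is"])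
       (auto simp: length_Suc_conv power_add)
  finally show ?case .
qed

lemma summable_geometric_multi_index:
  fixes r :: real
  assumes "0 \<le> r" "r < 1"
  shows "(\<lambda>is. r ^ sum_list is) summable_on {is. length is = d}"
  using has_sum_geometric_multi_index[OF assms] by (auto simp: summable_on_def)

text \<open>
  The finite exceptional set \<open>S\<close> absorbs factors that may vanish, where no logarithm exists.
  Convergence of the product along finite sets is then inherited from the sum of the logarithms by
  continuity of the exponential function.
\<close>
lemma unordered_prod_eq_exp_infsum:
  assumes S: "finite S" "S \<subseteq> A" and L: "L summable_on (A - S)"
    and f: "\<And>x. x \<in> A - S \<Longrightarrow> f x = exp (L x)"
  shows "unordered_prod f A = prod f S * exp (infsum L (A - S))"
  unfolding unordered_prod_def
proof (rule tendsto_Lim)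
  define g where "g x = (if x \<in> S then 0 else L x)" for x
  have "(L has_sum infsum L (A - S)) (A - S)"
    using L by simp
  also have "?this \<longleftrightarrow> (g has_sum infsum L (A - S)) A"
    by (intro has_sum_cong_neutral) (auto simp: g_def)
  finally have "((\<lambda>F. prod f S * exp (sum g F)) \<longlongrightarrow> prod f S * exp (infsum L (A - S)))
                  (finite_subsets_at_top A)"
    unfolding has_sum_def by (intro tendsto_intros)
  moreover have "eventually (\<lambda>F. prod f S * exp (sum g F) = prod f F) (finite_subsets_at_top A)"
    unfolding eventually_finite_subsets_at_top
  proof (intro exI conjI allI impI)
    fix F assume F: "finite F \<and> S \<subseteq> F \<and> F \<subseteq> A"
    have "sum g F = sum L (F - S)"
      using F S by (intro sum.mono_neutral_cong_right) (auto simp: g_def)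
    moreover have "prod f (F - S) = exp (sum L (F - S))"
      using F f by (subst exp_sum) (auto intro!: prod.cong)
    moreover have "prod f F = prod f (F - S) * prod f S"
      using F by (intro prod.subset_diff) auto
    ultimately show "prod f S * exp (sum g F) = prod f F"
      by (simp add: mult.commute)
  qed (use S in auto)
  ultimately show "((\<lambda>F. \<Prod>x\<in>F. f x) \<longlongrightarrow> prod f S * exp (infsum L (A - S))) (finite_subsets_at_top A)"
    by (rule Lim_transform_eventually)
qed auto

text \<open>
  The derivative of \<open>Ln (1 - v)\<close> has norm at most \<open>1 / (1 - r)\<close> on the disc of radius \<open>r\<close>.
\<close>
lemma norm_Ln_one_minus_le:
  fixes u :: complex
  assumes "norm u \<le> r" "r < 1"
  shows "norm (Ln (1 - u)) \<le> norm u / (1 - r)"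
proof -
  have "norm (Ln (1 - u) - Ln (1 - 0)) \<le> (1 / (1 - r)) * norm (u - 0)"
  proof (rule field_differentiable_bound[of "cball 0 r" _ "\<lambda>v. - 1 / (1 - v)"])
    fix v :: complex assume v: "v \<in> cball 0 r"
    have "Re v < 1"
      using v assms complex_Re_le_cmod[of v] by auto
    hence "1 - v \<notin> \<real>\<^sub>\<le>\<^sub>0"
      by (auto simp: complex_nonpos_Reals_iff)
    thus "((\<lambda>v. Ln (1 - v)) has_field_derivative - 1 / (1 - v)) (at v within cball 0 r)"
      by (auto intro!: derivative_eq_intros simp: field_simps)
    have "1 - r \<le> norm (1 - v)"
      using norm_triangle_ineq2[of 1 v] v by auto
    thus "norm (- 1 / (1 - v)) \<le> 1 / (1 - r)"
      using assms by (auto simp: norm_divide intro!: divide_left_mono mult_pos_pos)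
  qed (use assms in \<open>auto intro: order_trans[OF norm_ge_zero]\<close>)
  thus ?thesis by simp
qed

lemma summable_Ln_one_minus:
  fixes f :: "'i \<Rightarrow> complex"
  assumes M: "M summable_on A" and f: "\<And>x. x \<in> A \<Longrightarrow> norm (f x) \<le> M x"
    and r: "\<And>x. x \<in> A \<Longrightarrow> M x \<le> r" "r < 1"
  shows "(\<lambda>x. Ln (1 - f x)) summable_on A"
proof -
  have "(\<lambda>x. M x * (1 / (1 - r))) summable_on A"
    by (intro summable_on_cmult_left M)
  hence "(\<lambda>x. norm (Ln (1 - f x))) summable_on A"
  proof (rule Infinite_Sum.abs_summable_on_comparison_test')
    fix x assume x: "x \<in> A"
    have "norm (Ln (1 - f x)) \<le> norm (f x) / (1 - r)"
      using f[OF x] r(1)[OF x] r(2) by (intro norm_Ln_one_minus_le) auto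
    also have "\<dots> \<le> M x * (1 / (1 - r))"
      using f[OF x] r(2) by (simp add: divide_right_mono)
    finally show "norm (Ln (1 - f x)) \<le> M x * (1 / (1 - r))" .
  qed
  thus ?thesis by (rule abs_summable_summable)
qed

text \<open>
  The partial sums over finite index sets are holomorphic and, by the M-test, converge uniformly.
\<close>
lemma holomorphic_infsum_Ln_one_minus:
  fixes f :: "'i \<Rightarrow> complex \<Rightarrow> complex"
  assumes U: "open U" and hol: "\<And>x. x \<in> A \<Longrightarrow> f x holomorphic_on U"
    and M: "M summable_on A" and f: "\<And>x w. x \<in> A \<Longrightarrow> w \<in> U \<Longrightarrow> norm (f x w) \<le> M x"
    and r: "\<And>x. x \<in> A \<Longrightarrow> M x \<le> r" "r < 1"
  shows "(\<lambda>w. \<Sum>\<^sub>\<infinity>x\<in>A. Ln (1 - f x w)) holomorphic_on U"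
proof -
  have Lhol: "(\<lambda>w. Ln (1 - f x w)) holomorphic_on U" if x: "x \<in> A" for x
  proof -
    have "1 - f x w \<notin> \<real>\<^sub>\<le>\<^sub>0" if "w \<in> U" for w
    proof -
      have "Re (f x w) < 1"
        using f[OF x that] r(1)[OF x] r(2) complex_Re_le_cmod[of "f x w"] by linarith
      thus ?thesis by (auto simp: complex_nonpos_Reals_iff)
    qed
    thus ?thesis using hol[OF x] by (intro holomorphic_intros) auto
  qed
  have lim: "uniform_limit U (\<lambda>X w. \<Sum>x\<in>X. Ln (1 - f x w)) (\<lambda>w. \<Sum>\<^sub>\<infinity>x\<in>A. Ln (1 - f x w))
               (finite_subsets_at_top A)"
  proof (rule Weierstrass_m_test_general)
    show "(\<lambda>x. M x * (1 / (1 - r))) summable_on A"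
      by (intro summable_on_cmult_left M)
    fix x w assume x: "x \<in> A" and w: "w \<in> U"
    have "norm (Ln (1 - f x w)) \<le> norm (f x w) / (1 - r)"
      using f[OF x w] r(1)[OF x] r(2) by (intro norm_Ln_one_minus_le) auto
    also have "\<dots> \<le> M x * (1 / (1 - r))"
      using f[OF x w] r(2) by (simp add: divide_right_mono)
    finally show "norm (Ln (1 - f x w)) \<le> M x * (1 / (1 - r))" .
  qed
  have "(\<lambda>w. \<Sum>\<^sub>\<infinity>x\<in>A. Ln (1 - f x w)) analytic_on U"
    unfolding analytic_on_def
  proof
    fix z assume "z \<in> U"
    then obtain e where e: "e > 0" "cball z e \<subseteq> U"
      using U open_contains_cball by blast
    have "(\<lambda>w. \<Sum>\<^sub>\<infinity>x\<in>A. Ln (1 - f x w)) holomorphic_on ball z e"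
    proof (rule holomorphic_uniform_limit)
      show "uniform_limit (cball z e) (\<lambda>X w. \<Sum>x\<in>X. Ln (1 - f x w))
              (\<lambda>w. \<Sum>\<^sub>\<infinity>x\<in>A. Ln (1 - f x w)) (finite_subsets_at_top A)"
        using lim e(2) by (rule uniform_limit_on_subset)
      show "\<forall>\<^sub>F X in finite_subsets_at_top A. continuous_on (cball z e) (\<lambda>w. \<Sum>x\<in>X. Ln (1 - f x w)) \<and>
              (\<lambda>w. \<Sum>x\<in>X. Ln (1 - f x w)) holomorphic_on ball z e"
      proof (intro eventually_finite_subsets_at_top_weakI)
        fix X assume X: "finite X" "X \<subseteq> A"
        have "(\<lambda>w. \<Sum>x\<in>X. Ln (1 - f x w)) holomorphic_on cball z e"
          using X Lhol e by (intro holomorphic_on_sum) (auto intro: holomorphic_on_subset)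
        thus "continuous_on (cball z e) (\<lambda>w. \<Sum>x\<in>X. Ln (1 - f x w)) \<and>
              (\<lambda>w. \<Sum>x\<in>X. Ln (1 - f x w)) holomorphic_on ball z e"
          by (auto intro: holomorphic_on_imp_continuous_on holomorphic_on_subset)
      qed
    qed auto
    thus "\<exists>e>0. (\<lambda>w. \<Sum>\<^sub>\<infinity>x\<in>A. Ln (1 - f x w)) holomorphic_on ball z e"
      using e by blast
  qed
  thus ?thesis by (rule analytic_imp_holomorphic)
qed

lemma finite_large_terms_of_summable:
  fixes M :: "'i \<Rightarrow> real"
  assumes "M summable_on A" "\<And>x. x \<in> A \<Longrightarrow> M x \<ge> 0" "\<epsilon> > 0"
  shows "finite {x \<in> A. M x > \<epsilon>}"
proof (rule ccontr)
  assume inf: "infinite {x \<in> A. M x > \<epsilon>}"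
  obtain n :: nat where n: "infsum M A < of_nat n * \<epsilon>"
    using assms(3) reals_Archimedean3 by blast
  obtain F where F: "finite F" "card F = n" "F \<subseteq> {x \<in> A. M x > \<epsilon>}"
    using infinite_arbitrarily_large[OF inf] by blast
  have "of_nat n * \<epsilon> \<le> sum M F"
    using F sum_mono[of F "\<lambda>_. \<epsilon>" M] by (force simp: less_imp_le)
  also have "\<dots> \<le> infsum M A"
    using F assms by (intro finite_sum_le_infsum) auto
  finally show False using n by simp
qed

lemma unordered_prod_one_minus:
  fixes u :: "'i \<Rightarrow> complex"
  assumes summable: "(\<lambda>x. norm (u x)) summable_on A" and S: "finite S" "S \<subseteq> A"
    and small: "\<And>x. x \<in> A - S \<Longrightarrow> norm (u x) \<le> 1 / 2"
  shows "(\<lambda>x. Ln (1 - u x)) summable_on (A - S)"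
    and "unordered_prod (\<lambda>x. 1 - u x) A = (\<Prod>x\<in>S. 1 - u x) * exp (\<Sum>\<^sub>\<infinity>x\<in>A-S. Ln (1 - u x))"
proof -
  show L: "(\<lambda>x. Ln (1 - u x)) summable_on (A - S)"
    by (rule summable_Ln_one_minus[where M = "\<lambda>x. norm (u x)" and r = "1/2"])
       (use small in \<open>auto intro: summable_on_subset_banach[OF summable]\<close>)
  show "unordered_prod (\<lambda>x. 1 - u x) A = (\<Prod>x\<in>S. 1 - u x) * exp (\<Sum>\<^sub>\<infinity>x\<in>A-S. Ln (1 - u x))"
  proof (rule unordered_prod_eq_exp_infsum[OF S L])
    fix x assume "x \<in> A - S"
    hence "u x \<noteq> 1"
      using small[of x] by auto
    thus "1 - u x = exp (Ln (1 - u x))" by simp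
  qed
qed

text \<open>
  Splitting off the finitely many factors that are not close to 1 reduces this to additivity of the
  sum of the logarithms.
\<close>
lemma unordered_prod_one_minus_Un:
  fixes u :: "'i \<Rightarrow> complex"
  assumes summable: "(\<lambda>x. norm (u x)) summable_on (A \<union> B)" and disj: "A \<inter> B = {}"
  shows "unordered_prod (\<lambda>x. 1 - u x) (A \<union> B) =
           unordered_prod (\<lambda>x. 1 - u x) A * unordered_prod (\<lambda>x. 1 - u x) B"
proof -
  define S where "S = {x \<in> A \<union> B. norm (u x) > 1 / 2}"
  have fin: "finite S"
    unfolding S_def by (rule finite_large_terms_of_summable[OF summable]) auto
  have sub: "(\<lambda>x. norm (u x)) summable_on C" if "C \<subseteq> A \<union> B" for C
    using summable that by (rule summable_on_subset_banach)
  have dec: "(\<lambda>x. Ln (1 - u x)) summable_on (C - S \<inter> C)"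
      "unordered_prod (\<lambda>x. 1 - u x) C = (\<Prod>x\<in>S\<inter>C. 1 - u x) * exp (\<Sum>\<^sub>\<infinity>x\<in>C-S\<inter>C. Ln (1 - u x))"
    if "C \<subseteq> A \<union> B" for C
    using that fin by (auto intro!: unordered_prod_one_minus sub simp: S_def not_less)
  have "(\<Prod>x\<in>S\<inter>(A\<union>B). 1 - u x) = (\<Prod>x\<in>S\<inter>A. 1 - u x) * (\<Prod>x\<in>S\<inter>B. 1 - u x)"
    using disj fin by (subst prod.union_disjoint [symmetric]) (auto simp: Int_Un_distrib)
  moreover have "(\<Sum>\<^sub>\<infinity>x\<in>(A\<union>B)-S\<inter>(A\<union>B). Ln (1 - u x)) =
      (\<Sum>\<^sub>\<infinity>x\<in>A-S\<inter>A. Ln (1 - u x)) + (\<Sum>\<^sub>\<infinity>x\<in>B-S\<inter>B. Ln (1 - u x))"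
    using disj dec(1)[of A] dec(1)[of B]
    by (subst infsum_Un_disjoint [symmetric]) (auto intro!: arg_cong2[of _ _ _ _ infsum])
  ultimately show ?thesis
    using dec(2)[of A] dec(2)[of B] dec(2)[of "A \<union> B"] by (simp add: exp_add)
qed

lemma unordered_prod_cong:
  assumes "\<And>x. x \<in> A \<Longrightarrow> f x = g x"
  shows "unordered_prod f A = unordered_prod g A"
proof -
  have "eventually (\<lambda>F. prod f F = prod g F) (finite_subsets_at_top A)"
    using assms by (intro eventually_finite_subsets_at_top_weakI prod.cong) auto
  from tendsto_cong[OF this] show ?thesis
    unfolding unordered_prod_def Topological_Spaces.Lim_def by simp
qed

lemma unordered_prod_reindex:
  assumes "inj_on h A"
  shows "unordered_prod f (h ` A) = unordered_prod (\<lambda>x. f (h x)) A"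
proof -
  have ev: "eventually (\<lambda>F. prod f (h ` F) = (\<Prod>x\<in>F. f (h x))) (finite_subsets_at_top A)"
  proof (rule eventually_finite_subsets_at_top_weakI)
    fix F assume "finite F" "F \<subseteq> A"
    thus "prod f (h ` F) = (\<Prod>x\<in>F. f (h x))"
      using assms by (subst prod.reindex) (auto intro: inj_on_subset)
  qed
  have "(prod f \<longlongrightarrow> l) (finite_subsets_at_top (h ` A)) \<longleftrightarrow>
        ((\<lambda>F. \<Prod>x\<in>F. f (h x)) \<longlongrightarrow> l) (finite_subsets_at_top A)" for l
    unfolding filtermap_image_finite_subsets_at_top[OF assms, symmetric] filterlim_filtermap
    by (rule tendsto_cong[OF ev])
  thus ?thesis
    unfolding unordered_prod_def Topological_Spaces.Lim_def by simp
qed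

section \<open>Multifactorials and their logarithms\<close>

lemma summable_norm_q_multifactorial_term:
  fixes a q :: complex
  assumes "norm q < 1"
  shows "(\<lambda>is. norm (a * q ^ sum_list is)) summable_on {is. length is = d}"
  unfolding norm_mult norm_power
  by (intro summable_on_cmult_right summable_geometric_multi_index) (use assms in auto)

text \<open>
  A multi-index of length \<open>d + 1\<close> either starts with 0, and then it is a multi-index of length \<open>d\<close>,
  or lowering its first entry by 1 gives an arbitrary multi-index of length \<open>d + 1\<close> and turns \<open>a\<close>
  into \<open>a q\<close>.
\<close>
lemma q_multifactorial_Suc:
  assumes q: "norm q < 1"
  shows "q_multifactorial a q (Suc d) = q_multifactorial a q d * q_multifactorial (a * q) q (Suc d)"
proof -
  define B where "B = {is :: nat list. length is = d}"
  define C where "C = {is :: nat list. length is = Suc d}"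
  define up where "up is = Suc (hd is) # tl is" for "is" :: "nat list"
  have split: "C = (#) 0 ` B \<union> up ` C"
  proof (intro equalityI subsetI)
    fix js assume "js \<in> C"
    then obtain n ks where js: "js = n # ks" "ks \<in> B"
      by (auto simp: B_def C_def length_Suc_conv)
    show "js \<in> (#) 0 ` B \<union> up ` C"
    proof (cases n)
      case (Suc m)
      hence "js = up (m # ks)" "m # ks \<in> C"
        using js by (auto simp: up_def B_def C_def)
      thus ?thesis by blast
    qed (use js in auto)
  qed (auto simp: B_def C_def up_def)
  have Cons: "\<exists>n ks. js = n # ks" if "js \<in> C" for js
    using that by (auto simp: C_def length_Suc_conv)
  have inj: "inj_on up C"
  proof (rule inj_onI)
    fix js ks assume *: "js \<in> C" "ks \<in> C" "up js = up ks"
    thus "js = ks"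
      using Cons[OF *(1)] Cons[OF *(2)] by (auto simp: up_def)
  qed
  have up: "a * q ^ sum_list (up js) = a * q * q ^ sum_list js" if "js \<in> C" for js
    using Cons[OF that] by (auto simp: up_def)
  have "q_multifactorial a q (Suc d) = unordered_prod (\<lambda>is. 1 - a * q ^ sum_list is) ((#) 0 ` B \<union> up ` C)"
    unfolding q_multifactorial_def C_def[symmetric] split[symmetric] ..
  also have "\<dots> = unordered_prod (\<lambda>is. 1 - a * q ^ sum_list is) ((#) 0 ` B) *
                  unordered_prod (\<lambda>is. 1 - a * q ^ sum_list is) (up ` C)"
  proof (rule unordered_prod_one_minus_Un)
    show "(\<lambda>is. norm (a * q ^ sum_list is)) summable_on (#) 0 ` B \<union> up ` C"
      using summable_norm_q_multifactorial_term[OF q, of a "Suc d"]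
      unfolding C_def[symmetric] split[symmetric] .
  qed (auto simp: up_def)
  also have "unordered_prod (\<lambda>is. 1 - a * q ^ sum_list is) ((#) 0 ` B) = q_multifactorial a q d"
    unfolding q_multifactorial_def B_def by (subst unordered_prod_reindex) auto
  also have "unordered_prod (\<lambda>is. 1 - a * q ^ sum_list is) (up ` C) = q_multifactorial (a * q) q (Suc d)"
    unfolding unordered_prod_reindex[OF inj] q_multifactorial_def C_def[symmetric]
    by (rule unordered_prod_cong) (simp add: up)
  finally show ?thesis .
qed

definition log_q_multifactorial :: "complex \<Rightarrow> complex \<Rightarrow> nat \<Rightarrow> complex" where
  "log_q_multifactorial a q d = (\<Sum>\<^sub>\<infinity>is\<in>{is. length is = d}. Ln (1 - a * q ^ sum_list is))"

lemma norm_q_multifactorial_term_le: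
  fixes a q :: complex
  assumes "norm q < 1"
  shows "norm (a * q ^ n) \<le> norm a"
  using assms by (simp add: norm_mult norm_power mult_left_le power_le_one)

lemma log_q_multifactorial_summable:
  assumes "norm a < 1" "norm q < 1"
  shows "(\<lambda>is. Ln (1 - a * q ^ sum_list is)) summable_on {is. length is = d}"
  by (rule summable_Ln_one_minus[OF summable_norm_q_multifactorial_term[of q a] order.refl])
     (use assms norm_q_multifactorial_term_le[of q a] in auto)

lemma q_multifactorial_eq_exp:
  assumes "norm a < 1" "norm q < 1"
  shows "q_multifactorial a q d = exp (log_q_multifactorial a q d)"
proof -
  have "a * q ^ n \<noteq> 1" for n
    using norm_q_multifactorial_term_le[OF assms(2), of a n] assms(1) by auto
  thus ?thesis
    unfolding q_multifactorial_def log_q_multifactorial_def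
    using log_q_multifactorial_summable[OF assms]
    by (subst unordered_prod_eq_exp_infsum[where S = "{}" and L = "\<lambda>is. Ln (1 - a * q ^ sum_list is)"]) auto
qed

text \<open>
  Since powers are taken factor by factor, the exponent multiplies the sum of the principal
  logarithms; in particular the power is an entire function of \<open>w\<close> without zeros.
\<close>
lemma q_multifactorial_powr_eq_exp:
  assumes "norm a < 1" "norm q < 1"
  shows "q_multifactorial_powr a q d w = exp (w * log_q_multifactorial a q d)"
proof -
  have "a * q ^ n \<noteq> 1" for n
    using norm_q_multifactorial_term_le[OF assms(2), of a n] assms(1) by auto
  moreover have "(\<lambda>is. w * Ln (1 - a * q ^ sum_list is)) summable_on {is. length is = d}"
    by (intro summable_on_cmult_right log_q_multifactorial_summable assms)
  ultimately show ?thesis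
    unfolding q_multifactorial_powr_def log_q_multifactorial_def
    by (subst unordered_prod_eq_exp_infsum[where S = "{}" and L = "\<lambda>is. w * Ln (1 - a * q ^ sum_list is)"])
       (auto simp: powr_def infsum_cmult_right')
qed

text \<open>
  Compactness of a small closed disc makes the bounds uniform, and keeps \<open>norm (s w)\<close> away from 1.
\<close>
lemma locally_norm_bounds:
  fixes s :: "complex \<Rightarrow> complex"
  assumes "open U" "z \<in> U" "s holomorphic_on U" "g holomorphic_on U" "\<And>w. w \<in> U \<Longrightarrow> norm (s w) < 1"
  obtains e r C where "e > 0" "cball z e \<subseteq> U" "0 \<le> r" "r < 1" "C \<ge> 0"
    "\<And>w. w \<in> cball z e \<Longrightarrow> norm (s w) \<le> r" "\<And>w. w \<in> cball z e \<Longrightarrow> norm (g w :: complex) \<le> C"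
proof -
  obtain e where e: "e > 0" "cball z e \<subseteq> U"
    using assms open_contains_cball by blast
  have cont: "continuous_on (cball z e) (\<lambda>w. norm (s w))" "continuous_on (cball z e) (\<lambda>w. norm (g w))"
    using assms e by (auto intro!: continuous_intros holomorphic_on_imp_continuous_on
        intro: holomorphic_on_subset)
  obtain x where x: "x \<in> cball z e" "\<And>w. w \<in> cball z e \<Longrightarrow> norm (s w) \<le> norm (s x)"
    using continuous_attains_sup[OF compact_cball _ cont(1)] e by auto
  obtain y where y: "y \<in> cball z e" "\<And>w. w \<in> cball z e \<Longrightarrow> norm (g w) \<le> norm (g y)"
    using continuous_attains_sup[OF compact_cball _ cont(2)] e by auto
  show ?thesis
    by (rule that[of e "norm (s x)" "norm (g y)"]) (use e x y assms in auto)
qed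

text \<open>
  Both arguments may depend on the variable: the multigamma functions are considered as functions of
  \<open>z\<close> with \<open>q\<close> fixed and as functions of \<open>q\<close> with \<open>z\<close> fixed. Near a given point, the factors that
  can be far from 1 belong to a finite set of multi-indices that does not depend on the variable.
\<close>
lemma holomorphic_q_multifactorial:
  assumes U: "open U" and g: "g holomorphic_on U" and s: "s holomorphic_on U"
    and less: "\<And>w. w \<in> U \<Longrightarrow> norm (s w) < 1"
  shows "(\<lambda>w. q_multifactorial (g w) (s w) d) holomorphic_on U"
proof (rule analytic_imp_holomorphic, unfold analytic_on_def, rule)
  fix z assume z: "z \<in> U"
  obtain e r C where e: "e > 0" "cball z e \<subseteq> U" and r: "0 \<le> r" "r < 1" and C: "C \<ge> 0"
    and bound: "\<And>w. w \<in> cball z e \<Longrightarrow> norm (s w) \<le> r" "\<And>w. w \<in> cball z e \<Longrightarrow> norm (g w) \<le> C"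
    using locally_norm_bounds[OF U z s g less] by metis
  define A where "A = {is :: nat list. length is = d}"
  define M where "M is = C * r ^ sum_list is" for "is"
  have M: "M summable_on A"
    unfolding M_def A_def by (intro summable_on_cmult_right summable_geometric_multi_index r)
  define S where "S = {is \<in> A. M is > 1 / 2}"
  have S: "finite S" "S \<subseteq> A"
    using finite_large_terms_of_summable[OF M, of "1/2"] C r by (auto simp: S_def M_def)
  have le: "norm (g w * s w ^ sum_list is) \<le> M is" if "w \<in> ball z e" for w "is"
    unfolding M_def norm_mult norm_power
    using bound[of w] that C by (intro mult_mono power_mono) auto
  have hol: "(\<lambda>w. g w * s w ^ n) holomorphic_on ball z e" for n
    by (intro holomorphic_intros holomorphic_on_subset[OF g] holomorphic_on_subset[OF s]) (use e in auto)
  have "(\<lambda>w. \<Sum>\<^sub>\<infinity>is\<in>A-S. Ln (1 - g w * s w ^ sum_list is)) holomorphic_on ball z e"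
    by (rule holomorphic_infsum_Ln_one_minus[where M = M and r = "1/2"])
       (use hol le S in \<open>auto simp: S_def intro: summable_on_subset_banach[OF M]\<close>)
  hence "(\<lambda>w. (\<Prod>is\<in>S. 1 - g w * s w ^ sum_list is) *
            exp (\<Sum>\<^sub>\<infinity>is\<in>A-S. Ln (1 - g w * s w ^ sum_list is))) holomorphic_on ball z e"
    by (intro holomorphic_intros hol)
  moreover have "q_multifactorial (g w) (s w) d = (\<Prod>is\<in>S. 1 - g w * s w ^ sum_list is) *
            exp (\<Sum>\<^sub>\<infinity>is\<in>A-S. Ln (1 - g w * s w ^ sum_list is))" if w: "w \<in> ball z e" for w
    unfolding q_multifactorial_def A_def[symmetric]
  proof (rule unordered_prod_one_minus(2)[OF _ S])
    show "(\<lambda>is. norm (g w * s w ^ sum_list is)) summable_on A"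
      unfolding A_def using w e by (intro summable_norm_q_multifactorial_term less) auto
    show "norm (g w * s w ^ sum_list is) \<le> 1 / 2" if "is \<in> A - S" for "is"
      using le[OF w, of "is"] that by (auto simp: S_def)
  qed
  ultimately have "(\<lambda>w. q_multifactorial (g w) (s w) d) holomorphic_on ball z e"
    by (subst holomorphic_cong[OF refl]) auto
  thus "\<exists>e>0. (\<lambda>w. q_multifactorial (g w) (s w) d) holomorphic_on ball z e"
    using e by blast
qed

lemma holomorphic_log_q_multifactorial:
  "(\<lambda>q. log_q_multifactorial q q d) holomorphic_on ball 0 1"
proof (rule analytic_imp_holomorphic, unfold analytic_on_def, rule)
  fix z :: complex assume z: "z \<in> ball 0 1"
  obtain e r C where e: "e > 0" "cball z e \<subseteq> ball 0 1" and r: "0 \<le> r" "r < 1"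
    and bound: "\<And>w. w \<in> cball z e \<Longrightarrow> norm w \<le> r"
    by (rule locally_norm_bounds[OF _ z, of "\<lambda>w. w" "\<lambda>w. w"]) auto
  have "(\<lambda>q. \<Sum>\<^sub>\<infinity>is\<in>{is. length is = d}. Ln (1 - q * q ^ sum_list is)) holomorphic_on ball z e"
  proof (rule holomorphic_infsum_Ln_one_minus[where M = "\<lambda>is. r * r ^ sum_list is" and r = r])
    show "(\<lambda>is. r * r ^ sum_list is) summable_on {is. length is = d}"
      by (intro summable_on_cmult_right summable_geometric_multi_index r)
    show "norm (q * q ^ sum_list is) \<le> r * r ^ sum_list is" if "q \<in> ball z e" for q "is"
      unfolding norm_mult norm_power using bound[of q] that r by (intro mult_mono power_mono) auto
  qed (use r in \<open>auto intro!: holomorphic_intros mult_left_le power_le_one\<close>)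
  thus "\<exists>e>0. (\<lambda>q. log_q_multifactorial q q d) holomorphic_on ball z e"
    unfolding log_q_multifactorial_def using e by blast
qed

section \<open>Periodic functions with a derivative of constant sign\<close>

text \<open>
  Iterated derivatives are handled through an explicit sequence of functions, each the derivative of
  its predecessor; such sequences can be added and subtracted without differentiability conditions.
\<close>
lemma nth_deriv_eqI:
  fixes f :: "real \<Rightarrow> real"
  assumes "\<And>x. x > 0 \<Longrightarrow> f x = D 0 x"
    and "\<And>n x. x > 0 \<Longrightarrow> (D n has_real_derivative D (Suc n) x) (at x)"
  shows "x > 0 \<Longrightarrow> (deriv ^^ n) f x = D n x"
proof (induction n arbitrary: x)
  case (Suc n)
  have "eventually (\<lambda>t. t > 0) (nhds x)"
    using Suc.prems by (rule order_tendstoD(1)[OF filterlim_ident])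
  hence "deriv ((deriv ^^ n) f) x = deriv (D n) x"
    by (intro deriv_cong_ev refl) (auto elim: eventually_mono simp: Suc.IH)
  also have "\<dots> = D (Suc n) x"
    using assms(2)[OF Suc.prems] by (rule DERIV_imp_deriv)
  finally show ?case by simp
qed (use assms in auto)

text \<open>
  Differentiating \<open>D 0 (x + 1) = D 0 x\<close> repeatedly preserves the period.
\<close>
lemma derivatives_of_periodic:
  fixes D :: "nat \<Rightarrow> real \<Rightarrow> real"
  assumes deriv: "\<And>n x. x > 0 \<Longrightarrow> (D n has_real_derivative D (Suc n) x) (at x)"
    and periodic: "\<And>x. x > 0 \<Longrightarrow> D 0 (x + 1) = D 0 x"
    and x: "x > 0"
  shows "D n (x + real k) = D n x"
proof -
  have per: "D n (x + 1) = D n x" if "x > 0" for x n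
    using that
  proof (induction n arbitrary: x)
    case (Suc n)
    have "((\<lambda>t. D n (t + 1)) has_real_derivative D (Suc n) (x + 1)) (at x)"
      using deriv[of "x + 1" n] Suc.prems by (simp add: DERIV_shift)
    moreover have "eventually (\<lambda>t. t > 0) (nhds x)"
      using Suc.prems by (rule order_tendstoD(1)[OF filterlim_ident])
    hence ev: "eventually (\<lambda>t. D n (t + 1) = D n t) (nhds x)"
      by eventually_elim (rule Suc.IH)
    ultimately have "(D n has_real_derivative D (Suc n) (x + 1)) (at x)"
      by (simp only: DERIV_cong_ev[OF refl ev refl])
    with deriv[OF Suc.prems] show ?case
      by (rule DERIV_unique [symmetric])
  qed (rule periodic)
  show ?thesis
  proof (induction k)
    case (Suc k)
    have "D n (x + real (Suc k)) = D n ((x + real k) + 1)"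
      by (simp add: add_ac)
    also have "\<dots> = D n (x + real k)"
      by (rule per) (use x in simp)
    finally show ?case using Suc by simp
  qed simp
qed

text \<open>
  The derivative of order \<open>n\<close> is monotone and, like the function itself, periodic.
\<close>
lemma periodic_monotone_derivative_constant:
  fixes D :: "nat \<Rightarrow> real \<Rightarrow> real"
  assumes deriv: "\<And>n x. x > 0 \<Longrightarrow> (D n has_real_derivative D (Suc n) x) (at x)"
    and periodic: "\<And>x. x > 0 \<Longrightarrow> D 0 (x + 1) = D 0 x"
    and sign: "\<And>x. x > 0 \<Longrightarrow> D (Suc n) x \<ge> 0"
    and x: "x > 0" and y: "y > 0"
  shows "D n x = D n y"
proof -
  have mono: "D n s \<le> D n t" if st: "0 < s" "s \<le> t" for s t
  proof (rule DERIV_nonneg_imp_nondecreasing[OF st(2)])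
    fix r assume "s \<le> r"
    hence "r > 0" using st by simp
    from deriv[OF this, of n] sign[OF this]
    show "\<exists>y. (D n has_real_derivative y) (at r) \<and> 0 \<le> y" by blast
  qed
  have ge: "D n t \<le> D n s" if st: "0 < s" "0 < t" for s t
  proof -
    obtain k :: nat where k: "t - s \<le> real k"
      using real_arch_simple by blast
    have "D n t \<le> D n (s + real k)"
      using k by (intro mono st) simp
    also have "\<dots> = D n s"
      using derivatives_of_periodic[of D s n k, OF deriv periodic st(1)] .
    finally show ?thesis .
  qed
  show ?thesis
    using ge[OF x y] ge[OF y x] by (rule antisym[rotated])
qed

text \<open>
  A derivative of constant sign makes the derivative of the next lower order constant. A constant
  has a sign, so the argument descends to the function itself, after a change of sign if needed.
\<close>
lemma periodic_with_signed_derivative_constant: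
  fixes D :: "nat \<Rightarrow> real \<Rightarrow> real"
  assumes deriv: "\<And>n x. x > 0 \<Longrightarrow> (D n has_real_derivative D (Suc n) x) (at x)"
    and periodic: "\<And>x. x > 0 \<Longrightarrow> D 0 (x + 1) = D 0 x"
    and sign: "\<And>x. x > 0 \<Longrightarrow> D (Suc n) x \<ge> 0"
    and x: "x > 0" and y: "y > 0"
  shows "D 0 x = D 0 y"
  using deriv periodic sign
proof (induction n arbitrary: D)
  case 0
  show ?case
    using periodic_monotone_derivative_constant[of D 0 x y, OF 0 x y] .
next
  case (Suc n)
  have c: "D (Suc n) t = D (Suc n) x" if "t > 0" for t
    using periodic_monotone_derivative_constant[of D "Suc n" t x, OF Suc.prems that x] .
  show ?case
  proof (cases "D (Suc n) x \<ge> 0")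
    case True
    show ?thesis
    proof (rule Suc.IH[of D, OF Suc.prems(1,2)])
      fix t :: real assume "t > 0"
      from c[OF this] True show "D (Suc n) t \<ge> 0" by simp
    qed
  next
    case False
    have "- D 0 x = - D 0 y"
    proof (rule Suc.IH[of "\<lambda>n t. - D n t"])
      fix t :: real assume t: "t > 0"
      show "((\<lambda>t. - D m t) has_real_derivative - D (Suc m) t) (at t)" for m
        by (rule DERIV_minus[OF Suc.prems(1)[OF t]])
      show "- D 0 (t + 1) = - D 0 t"
        using Suc.prems(2)[OF t] by (rule arg_cong)
      show "- D (Suc n) t \<ge> 0"
        using c[OF t] False by simp
    qed
    thus ?thesis by simp
  qed
qed

section \<open>Derivatives of exponential series\<close>

lemma sums_times_index:
  fixes a :: "nat \<Rightarrow> real"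
  assumes "\<And>y. \<bar>y\<bar> < 1 \<Longrightarrow> summable (\<lambda>k. a k * y ^ k)" "\<bar>y\<bar> < 1"
  shows "(\<lambda>k. real k * a k * y ^ k) sums (y * (\<Sum>k. diffs a k * y ^ k))"
proof -
  have "summable (\<lambda>k. diffs a k * y ^ k)"
    using assms by (intro termdiff_converges[where K = 1]) auto
  hence "(\<lambda>k. y * (real k * a k * y ^ (k - Suc 0))) sums (y * (\<Sum>k. diffs a k * y ^ k))"
    by (intro sums_mult diffs_equiv)
  moreover have "y * (real k * a k * y ^ (k - Suc 0)) = real k * a k * y ^ k" for k
    by (cases k) auto
  ultimately show ?thesis by simp
qed

text \<open>
  Substituting \<open>q powr x\<close> into a power series turns termwise differentiation into multiplication of
  the coefficients by \<open>k * ln q\<close>, so the series keeps its form under repeated differentiation.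
\<close>
lemma exponential_series_derivative:
  fixes a :: "nat \<Rightarrow> real"
  assumes a: "\<And>y. \<bar>y\<bar> < 1 \<Longrightarrow> summable (\<lambda>k. a k * y ^ k)" and q: "0 < q" "q < 1" and x: "x > 0"
  shows "((\<lambda>x. \<Sum>k. a k * (q powr x) ^ k) has_real_derivative
           (\<Sum>k. (real k * ln q * a k) * (q powr x) ^ k)) (at x)"
proof -
  have y: "\<bar>q powr x\<bar> < 1"
    using q x by (simp add: powr_def mult_pos_neg)
  obtain K where K: "\<bar>q powr x\<bar> < K" "K < 1"
    using dense[OF y] by blast
  hence "\<bar>K\<bar> < 1"
    using abs_ge_zero[of "q powr x"] by linarith
  have "DERIV (\<lambda>y. \<Sum>k. a k * y ^ k) (q powr x) :> (\<Sum>k. diffs a k * (q powr x) ^ k)"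
    using K by (intro termdiffs_strong[where K = K] a \<open>\<bar>K\<bar> < 1\<close>) auto
  moreover have "((\<lambda>x. q powr x) has_real_derivative q powr x * ln q) (at x)"
    using q by (auto intro!: derivative_eq_intros)
  ultimately have "((\<lambda>x. \<Sum>k. a k * (q powr x) ^ k) has_real_derivative
      (\<Sum>k. diffs a k * (q powr x) ^ k) * (q powr x * ln q)) (at x)"
    by (rule DERIV_chain2)
  also have "(\<Sum>k. diffs a k * (q powr x) ^ k) * (q powr x * ln q) =
      ln q * (\<Sum>k. real k * a k * (q powr x) ^ k)"
    using sums_times_index[OF a y] by (simp add: sums_iff mult_ac)
  also have "\<dots> = (\<Sum>k. ln q * (real k * a k * (q powr x) ^ k))"
    using sums_times_index[OF a y] by (intro suminf_mult [symmetric]) (simp add: sums_iff)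
  finally show ?thesis by (simp add: mult_ac)
qed

lemma summable_times_index_power:
  fixes a :: "nat \<Rightarrow> real"
  assumes "\<And>y. \<bar>y\<bar> < 1 \<Longrightarrow> summable (\<lambda>k. a k * y ^ k)" "\<bar>y\<bar> < 1"
  shows "summable (\<lambda>k. (real k * c) ^ n * a k * y ^ k)"
  using assms(2)
proof (induction n arbitrary: y)
  case (Suc n)
  have "summable (\<lambda>k. c * (real k * ((real k * c) ^ n * a k) * y ^ k))"
    by (intro summable_mult sums_summable[OF sums_times_index]) (use Suc in auto)
  thus ?case by (simp add: mult_ac)
qed (use assms in auto)

lemma exponential_series_tendsto_0:
  fixes a :: "nat \<Rightarrow> real"
  assumes a: "\<And>y. \<bar>y\<bar> < 1 \<Longrightarrow> summable (\<lambda>k. a k * y ^ k)" and a0: "a 0 = 0" and q: "0 < q" "q < 1"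
  shows "(\<lambda>n. \<Sum>k. a k * (q powr (x + real n)) ^ k) \<longlonglongrightarrow> 0"
proof -
  have "isCont (\<lambda>y. \<Sum>k. a k * y ^ k) 0"
    using a[of "1/2"] by (intro isCont_powser[where K = "1/2"]) auto
  moreover have "(\<lambda>n. q powr x * q ^ n) \<longlonglongrightarrow> 0"
    using q by (auto intro!: tendsto_mult_right_zero LIMSEQ_realpow_zero)
  hence "(\<lambda>n. q powr (x + real n)) \<longlonglongrightarrow> 0"
    using q by (simp add: powr_add powr_realpow)
  ultimately have "(\<lambda>n. \<Sum>k. a k * (q powr (x + real n)) ^ k) \<longlonglongrightarrow> (\<Sum>k. a k * 0 ^ k)"
    by (rule isCont_tendsto_compose)
  also have "(\<Sum>k. a k * 0 ^ k) = 0"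
    using a0 by (subst powser_zero) auto
  finally show ?thesis .
qed

section \<open>Expansion of the logarithm of a multifactorial\<close>

text \<open>
  The coefficient of \<open>y^k\<close> in the expansion of minus the logarithm of the multifactorial at \<open>y\<close>. At
  \<open>k = 0\<close> it is 0 because division by 0 yields 0.
\<close>
definition log_multifactorial_coeff :: "real \<Rightarrow> nat \<Rightarrow> nat \<Rightarrow> real" where
  "log_multifactorial_coeff q d k = 1 / (real k * (1 - q ^ k) ^ d)"

lemma log_multifactorial_coeff_nonneg: "0 < q \<Longrightarrow> q < 1 \<Longrightarrow> log_multifactorial_coeff q d k \<ge> 0"
  by (auto simp: log_multifactorial_coeff_def power_le_one)

lemma log_multifactorial_coeff_0 [simp]: "log_multifactorial_coeff q d 0 = 0"
  by (simp add: log_multifactorial_coeff_def)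

lemma log_multifactorial_coeff_summable:
  assumes q: "0 < q" "q < 1" and y: "\<bar>y\<bar> < 1"
  shows "summable (\<lambda>k. log_multifactorial_coeff q d k * y ^ k)"
proof (rule summable_comparison_test')
  show "summable (\<lambda>k. 1 / (1 - q) ^ d * \<bar>y\<bar> ^ k)"
    using y by (intro summable_mult summable_geometric) auto
  fix k :: nat
  have "log_multifactorial_coeff q d k \<le> 1 / (1 - q) ^ d"
  proof (cases "k = 0")
    case False
    hence "q ^ k \<le> q ^ 1"
      using q by (intro power_decreasing) auto
    hence "1 * (1 - q) ^ d \<le> real k * (1 - q ^ k) ^ d"
      using False q by (intro mult_mono power_mono) auto
    thus ?thesis
      using q False unfolding log_multifactorial_coeff_def
      by (intro divide_left_mono mult_pos_pos zero_less_power) (auto simp: power_less_one_iff)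
  qed (use q in auto)
  thus "norm (log_multifactorial_coeff q d k * y ^ k) \<le> 1 / (1 - q) ^ d * \<bar>y\<bar> ^ k"
    using log_multifactorial_coeff_nonneg[OF q, of d k]
    by (auto simp: abs_mult power_abs intro!: mult_right_mono simp del: times_divide_eq_left)
qed

text \<open>
  The logarithms are expanded into \<open>\<Sum>k. y^k * q^(k * sum_list is) / k\<close>. All terms are nonnegative,
  so the summations over \<open>k\<close> and over the multi-indices may be exchanged, and the inner sum over the
  multi-indices is the geometric one.
\<close>
lemma has_sum_ln_one_minus_multi_index:
  assumes q: "0 < q" "q < 1" and y: "0 \<le> y" "y < 1"
  shows "((\<lambda>is. - ln (1 - y * q ^ sum_list is)) has_sum (\<Sum>k. log_multifactorial_coeff q d k * y ^ k)) {is. length is = d}"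
proof -
  define A where "A = {is :: nat list. length is = d}"
  define t where "t k is = y ^ k / real k * (q ^ k) ^ sum_list is" for k "is"
  have inner: "(t k has_sum log_multifactorial_coeff q d k * y ^ k) A" for k
  proof (cases "k = 0")
    case False
    hence "q ^ k < 1"
      using q by (simp add: power_Suc_less_one power_less_one_iff)
    hence "(t k has_sum y ^ k / real k * (1 / (1 - q ^ k) ^ d)) A"
      unfolding t_def A_def using q by (intro has_sum_cmult_right has_sum_geometric_multi_index) auto
    thus ?thesis by (simp add: log_multifactorial_coeff_def)
  qed (auto simp: t_def[abs_def] intro!: has_sum_0)
  have outer: "((\<lambda>k. log_multifactorial_coeff q d k * y ^ k) has_sum (\<Sum>k. log_multifactorial_coeff q d k * y ^ k)) UNIV"
    using log_multifactorial_coeff_summable[OF q, of y d] y log_multifactorial_coeff_nonneg[OF q]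
    by (intro sums_nonneg_imp_has_sum summable_sums) auto
  have t_nonneg: "t k is \<ge> 0" for k "is"
    using q y by (auto simp: t_def)
  have "(\<lambda>(k, is). t k is) summable_on UNIV \<times> A"
    using inner outer t_nonneg
    by (intro summable_on_SigmaI[where g = "\<lambda>k. log_multifactorial_coeff q d k * y ^ k"]) (auto simp: summable_on_def)
  hence "((\<lambda>(k, is). t k is) has_sum (\<Sum>k. log_multifactorial_coeff q d k * y ^ k)) (UNIV \<times> A)"
    using inner outer by (intro has_sum_SigmaI) auto
  also have "?this \<longleftrightarrow> ((\<lambda>(is, k). t k is) has_sum (\<Sum>k. log_multifactorial_coeff q d k * y ^ k)) (A \<times> UNIV)"
    by (intro has_sum_reindex_bij_witness[of _ "\<lambda>(a, b). (b, a)" "\<lambda>(a, b). (b, a)"]) auto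
  finally have "((\<lambda>is. - ln (1 - y * q ^ sum_list is)) has_sum (\<Sum>k. log_multifactorial_coeff q d k * y ^ k)) A"
  proof (rule has_sum_SigmaD)
    fix js
    define u where "u = y * q ^ sum_list js"
    have "u \<le> y * 1"
      unfolding u_def using q y by (intro mult_left_mono power_le_one) auto
    hence u: "0 \<le> u" "u < 1"
      using q y by (auto simp: u_def)
    have "(\<lambda>k. - (- ((- (- u)) ^ k) / real k)) sums (- ln (1 + (- u)))"
      using u by (intro sums_minus ln_series') auto
    hence "(\<lambda>k. u ^ k / real k) sums (- ln (1 - u))"
      by simp
    hence "((\<lambda>k. u ^ k / real k) has_sum (- ln (1 - u))) UNIV"
      using u by (intro sums_nonneg_imp_has_sum) auto
    thus "((\<lambda>k. case (js, k) of (is, k) \<Rightarrow> t k is) has_sum - ln (1 - y * q ^ sum_list js)) UNIV"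
      by (simp add: t_def u_def power_mult_distrib mult_ac flip: power_mult)
  qed
  thus ?thesis by (simp add: A_def)
qed

lemma log_q_multifactorial_of_real:
  assumes q: "0 < q" "q < 1" and y: "0 \<le> y" "y < 1"
  shows "log_q_multifactorial (of_real y) (of_real q) d = - of_real (\<Sum>k. log_multifactorial_coeff q d k * y ^ k)"
proof -
  have Ln: "Ln (1 - of_real y * of_real q ^ n) = - of_real (- ln (1 - y * q ^ n))" for n
  proof -
    have "y * q ^ n \<le> y * 1"
      using q y by (intro mult_left_mono power_le_one) auto
    hence "0 < 1 - y * q ^ n" using y by simp
    from Ln_of_real[OF this] show ?thesis by simp
  qed
  show ?thesis
    unfolding log_q_multifactorial_def Ln
    by (intro infsumI has_sum_uminusI has_sum_of_real has_sum_ln_one_minus_multi_index assms)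
qed

section \<open>The product formula as a function of both variables\<close>

text \<open>
  The logarithm of the product of the powers of the multifactorials \<open>(q;q)\<^sup>(\<^sup>i\<^sup>)\<close> in the formula for
  the value at \<open>z + 1\<close>; hence the shift by 1 in \<open>multigamma_product\<close>.
\<close>
definition log_prefactor :: "complex \<Rightarrow> nat \<Rightarrow> complex \<Rightarrow> complex" where
  "log_prefactor q d z =
     (\<Sum>i=0..d. (-1) ^ (i + 1) * (z gchoose (d - i)) * log_q_multifactorial q q i)"

definition multigamma_product :: "complex \<Rightarrow> nat \<Rightarrow> complex \<Rightarrow> complex" where
  "multigamma_product q d z =
     exp (log_prefactor q d (z - 1)) * q_multifactorial (q powr z) q d powi ((-1) ^ d)"

lemma holomorphic_gbinomial [holomorphic_intros]:
  "f holomorphic_on A \<Longrightarrow> (\<lambda>z. f z gchoose k) holomorphic_on A"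
  unfolding gbinomial_prod_rev by (intro holomorphic_intros) auto

text \<open>
  Pulling the inversion outside exhibits the product for odd \<open>d\<close> as the reciprocal of a holomorphic
  function; it takes the value 0 at the zeros of that function.
\<close>
lemma multigamma_product_altdef:
  "multigamma_product q d z =
     (if even d then exp (log_prefactor q d (z - 1)) * q_multifactorial (q powr z) q d
      else inverse (exp (- log_prefactor q d (z - 1)) * q_multifactorial (q powr z) q d))"
  by (simp add: multigamma_product_def power_int_minus exp_minus)

lemma nicely_meromorphic_multigamma_productI:
  assumes "open A" "q holomorphic_on A" "z holomorphic_on A"
    and q: "\<And>w. w \<in> A \<Longrightarrow> q w \<in> ball 0 1 - \<real>\<^sub>\<le>\<^sub>0"
  shows "(\<lambda>w. multigamma_product (q w) d (z w)) nicely_meromorphic_on A"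
    and "even d \<Longrightarrow> (\<lambda>w. multigamma_product (q w) d (z w)) holomorphic_on A"
    and "odd d \<Longrightarrow> (\<lambda>w. 1 / multigamma_product (q w) d (z w)) holomorphic_on A"
proof -
  have log: "(\<lambda>w. log_q_multifactorial (q w) (q w) i) holomorphic_on A" for i
    using holomorphic_on_compose_gen[OF assms(2) holomorphic_log_q_multifactorial[of i]] q
    by (auto simp: o_def image_subset_iff)
  have P: "(\<lambda>w. log_prefactor (q w) d (z w - 1)) holomorphic_on A"
    unfolding log_prefactor_def by (intro holomorphic_intros log assms)
  have "(\<lambda>w. exp (z w * Ln (q w))) holomorphic_on A"
    using q by (intro holomorphic_intros assms) auto
  moreover have "q w powr z w = exp (z w * Ln (q w))" if "w \<in> A" for w
    using q[OF that] by (auto simp: powr_def)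
  ultimately have "(\<lambda>w. q w powr z w) holomorphic_on A"
    by (subst holomorphic_cong[OF refl]) auto
  hence E: "(\<lambda>w. q_multifactorial (q w powr z w) (q w) d) holomorphic_on A"
    using q by (intro holomorphic_q_multifactorial assms) auto
  define g where "g s w = exp (s * log_prefactor (q w) d (z w - 1)) *
    q_multifactorial (q w powr z w) (q w) d" for s w
  have g: "g s holomorphic_on A" for s
    unfolding g_def by (intro holomorphic_intros P E)
  have eq: "multigamma_product (q w) d (z w) = (if even d then g 1 w else inverse (g (-1) w))" for w
    by (simp add: multigamma_product_altdef g_def)
  have g': "g s nicely_meromorphic_on A" for s
    using g assms(1) by (intro analytic_on_imp_nicely_meromorphic_on) (simp add: analytic_on_open)
  show "(\<lambda>w. multigamma_product (q w) d (z w)) nicely_meromorphic_on A"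
    unfolding eq using g'[of 1] nicely_meromorphic_on_inverse[OF g'[of "-1"]] by (cases "even d") auto
  show "(\<lambda>w. multigamma_product (q w) d (z w)) holomorphic_on A" if "even d"
    unfolding eq using that g by simp
  show "(\<lambda>w. 1 / multigamma_product (q w) d (z w)) holomorphic_on A" if "odd d"
    unfolding eq using that g by (simp add: inverse_eq_divide)
qed

text \<open>
  Pascal's rule for the terms with \<open>i \<le> d\<close>; the term with \<open>i = d + 1\<close> does not depend on \<open>z\<close>.
\<close>
lemma log_prefactor_Suc:
  "log_prefactor q (Suc d) (z + 1) = log_prefactor q d z + log_prefactor q (Suc d) z"
proof -
  define t where "t k w i = (-1) ^ (i + 1) * (w gchoose (k - i)) * log_q_multifactorial q q i"
    for k i :: nat and w
  have pascal: "t (Suc d) (z + 1) i = t d z i + t (Suc d) z i" if "i \<le> d" for i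
    unfolding t_def using that
    by (simp only: Suc_diff_le gbinomial_Suc_Suc) (simp add: algebra_simps)
  have "log_prefactor q (Suc d) (z + 1) = (\<Sum>i=0..d. t d z i + t (Suc d) z i) + t (Suc d) (z + 1) (Suc d)"
    unfolding log_prefactor_def t_def[symmetric] by (simp add: pascal)
  also have "t (Suc d) (z + 1) (Suc d) = t (Suc d) z (Suc d)"
    by (simp add: t_def)
  also have "(\<Sum>i=0..d. t d z i + t (Suc d) z i) + t (Suc d) z (Suc d) = log_prefactor q d z + log_prefactor q (Suc d) z"
    unfolding log_prefactor_def t_def[symmetric] by (simp add: sum.distrib)
  finally show ?thesis .
qed

text \<open>
  At a zero of the multifactorial of level \<open>d\<close>, that of level \<open>d + 1\<close> vanishes as well. There a zero
  meets a pole on the right-hand side, and the value 0 at poles can break the identity.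
\<close>
lemma multigamma_product_functional_equation:
  assumes q: "norm q < 1" "q \<noteq> 0" and nz: "q_multifactorial (q powr z) q d \<noteq> 0"
  shows "multigamma_product q (Suc d) (z + 1) = multigamma_product q d z * multigamma_product q (Suc d) z"
proof -
  have "log_prefactor q (Suc d) z = log_prefactor q d (z - 1) + log_prefactor q (Suc d) (z - 1)"
    using log_prefactor_Suc[of q d "z - 1"] by simp
  moreover have "q_multifactorial (q powr z) q (Suc d) =
      q_multifactorial (q powr z) q d * q_multifactorial (q powr (z + 1)) q (Suc d)"
    using q_multifactorial_Suc[OF q(1), of "q powr z" d] q(2) by (simp add: powr_add)
  ultimately show ?thesis
    using nz by (cases "even d") (simp_all add: multigamma_product_altdef exp_add exp_minus exp_diff field_simps)
qed

lemma multigamma_product_1: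
  assumes q: "norm q < 1"  "q \<noteq> 0"
  shows "multigamma_product q d 1 = 1"
proof -
  have "log_prefactor q d 0 = (\<Sum>i=0..d. if i = d then (-1) ^ (d + 1) * log_q_multifactorial q q d else 0)"
    unfolding log_prefactor_def by (intro sum.cong refl) (auto simp: gbinomial_0_left)
  also have "\<dots> = (-1) ^ (d + 1) * log_q_multifactorial q q d"
    by simp
  finally show ?thesis
    using q_multifactorial_eq_exp[OF q(1) q(1), of d] q
    by (simp add: multigamma_product_altdef exp_minus)
qed

lemma multigamma_product_0:
  assumes q: "norm q < 1" "q \<noteq> 0"
  shows "multigamma_product q 0 z = (1 - q powr z) / (1 - q)"
proof -
  have "1 - q \<noteq> 0" using q by auto
  moreover have "log_q_multifactorial q q 0 = Ln (1 - q)"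
    by (simp add: log_q_multifactorial_def)
  ultimately show ?thesis
    by (simp add: multigamma_product_def log_prefactor_def q_multifactorial_0 exp_minus field_simps)
qed

section \<open>The product formula for real base\<close>

lemma ex_poly_gbinomial:
  "\<exists>p. degree p \<le> k \<and> (\<forall>x::real. poly p x = x gchoose k)"
proof (intro exI conjI allI)
  let ?p = "smult (1 / fact k) (\<Prod>i=0..<k. [:- real i, 1:])"
  show "degree ?p \<le> k"
    by (rule order_trans[OF degree_smult_le]) (rule order_trans[OF degree_prod_sum_le], auto)
  show "poly ?p x = x gchoose k" for x
    by (simp add: gbinomial_prod_rev poly_prod)
qed

lemma of_real_gbinomial: "of_real (x gchoose k) = (of_real x gchoose k :: complex)"
  by (simp add: gbinomial_prod_rev)

text \<open>
  For each \<open>i\<close>, \<open>x - 1 gchoose (d - i)\<close> is a polynomial in \<open>x\<close> of degree at most \<open>d\<close>.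
\<close>
lemma multigamma_product_of_real:
  assumes q: "0 < q" "q < 1"
  obtains p where "degree p \<le> d"
    "\<And>x. x > 0 \<Longrightarrow> multigamma_product (of_real q) d (of_real x) =
       of_real (exp (poly p x + (-1) ^ Suc d * (\<Sum>k. log_multifactorial_coeff q d k * (q powr x) ^ k)))"
proof -
  obtain P where P: "\<And>k. degree (P k) \<le> k" "\<And>k x. poly (P k) x = (x gchoose k :: real)"
    using ex_poly_gbinomial by metis
  define l where "l i = - (\<Sum>k. log_multifactorial_coeff q i k * q ^ k)" for i
  define p where "p = (\<Sum>i=0..d. smult ((-1) ^ (i + 1) * l i) (P (d - i) \<circ>\<^sub>p [:-1, 1:]))"
  have deg: "degree p \<le> d"
    unfolding p_def
  proof (intro degree_sum_le order_trans[OF degree_smult_le] order_trans[OF degree_pcompose_le])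
    fix i show "degree (P (d - i)) * degree [:- 1, 1::real:] \<le> d"
      using P(1)[of "d - i"] by simp
  qed auto
  have "multigamma_product (of_real q) d (of_real x) =
       of_real (exp (poly p x + (-1) ^ Suc d * (\<Sum>k. log_multifactorial_coeff q d k * (q powr x) ^ k)))"
    if x: "x > 0" for x
  proof -
    have l: "log_q_multifactorial (of_real q) (of_real q) i = of_real (l i)" for i
      unfolding l_def using log_q_multifactorial_of_real[OF q, of q i] q by simp
    have *: "log_prefactor (of_real q) d (of_real x - 1) = of_real (poly p x)"
      unfolding log_prefactor_def l p_def
      by (simp add: poly_sum poly_pcompose P(2) of_real_gbinomial mult_ac)
    have y: "0 \<le> q powr x" "q powr x < 1"
      using q x by (auto simp: powr_def mult_pos_neg)
    have "of_real q powr of_real x = (of_real (q powr x) :: complex)"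
      using q by (simp add: powr_of_real)
    hence "q_multifactorial (of_real q powr of_real x) (of_real q) d =
        of_real (exp (- (\<Sum>k. log_multifactorial_coeff q d k * (q powr x) ^ k)))"
      using log_q_multifactorial_of_real[OF q y, of d] q y
      by (simp add: q_multifactorial_eq_exp flip: exp_of_real)
    thus ?thesis
      by (cases "even d")
         (simp_all add: multigamma_product_altdef * exp_add exp_minus exp_diff flip: exp_of_real, simp_all add: field_simps)
  qed
  with deg show ?thesis using that by blast
qed

text \<open>
  Differentiating \<open>d + 1\<close> times removes the polynomial part and leaves an exponential series whose
  coefficients are all nonnegative. The decay at infinity is what singles out this solution.
\<close>
lemma log_multigamma_product_derivatives:
  assumes q: "0 < q" "q < 1"
  obtains D :: "nat \<Rightarrow> real \<Rightarrow> real" where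
    "\<And>x. x > 0 \<Longrightarrow> ln (Re (multigamma_product (of_real q) d (of_real x))) = D 0 x"
    "\<And>n x. x > 0 \<Longrightarrow> (D n has_real_derivative D (Suc n) x) (at x)"
    "\<And>x. x > 0 \<Longrightarrow> D (Suc d) x \<ge> 0"
    "\<And>x. (\<lambda>n. D (Suc d) (x + real n)) \<longlonglongrightarrow> 0"
proof -
  obtain p where p: "degree p \<le> d"
    "\<And>x. x > 0 \<Longrightarrow> multigamma_product (of_real q) d (of_real x) =
       of_real (exp (poly p x + (-1) ^ Suc d * (\<Sum>k. log_multifactorial_coeff q d k * (q powr x) ^ k)))"
    using multigamma_product_of_real[OF q, where d = d] by metis
  define a where "a n k = (real k * ln q) ^ n * log_multifactorial_coeff q d k" for n k
  have a: "summable (\<lambda>k. a n k * y ^ k)" if "\<bar>y\<bar> < 1" for n y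
    unfolding a_def by (intro summable_times_index_power log_multifactorial_coeff_summable q that)
  define D where "D n x = poly ((pderiv ^^ n) p) x + (-1) ^ Suc d * (\<Sum>k. a n k * (q powr x) ^ k)" for n x
  have "(pderiv ^^ Suc d) p = 0"
    using p(1) by (intro poly_eqI) (simp add: coeff_higher_pderiv coeff_eq_0 del: funpow.simps)
  hence D_Suc: "D (Suc d) x = (-1) ^ Suc d * (\<Sum>k. a (Suc d) k * (q powr x) ^ k)" for x
    by (simp add: D_def del: funpow.simps)
  have sign: "(-1) ^ Suc d * a (Suc d) k \<ge> 0" for k
  proof -
    have "(-1) ^ Suc d * a (Suc d) k = (real k * (- ln q)) ^ Suc d * log_multifactorial_coeff q d k"
      unfolding a_def power_mult_distrib[symmetric] mult.assoc[symmetric] by simp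
    also have "\<dots> \<ge> 0"
      using q by (intro mult_nonneg_nonneg zero_le_power log_multifactorial_coeff_nonneg) auto
    finally show ?thesis .
  qed
  show ?thesis
  proof (rule that[of D])
    show "ln (Re (multigamma_product (of_real q) d (of_real x))) = D 0 x" if "x > 0" for x
      unfolding p(2)[OF that] by (simp add: D_def a_def)
    show "(D n has_real_derivative D (Suc n) x) (at x)" if x: "x > 0" for n x
    proof -
      have "((\<lambda>x. \<Sum>k. a n k * (q powr x) ^ k) has_real_derivative
          (\<Sum>k. a (Suc n) k * (q powr x) ^ k)) (at x)"
        using exponential_series_derivative[OF a q x, of n]
        by (simp add: a_def mult_ac)
      thus ?thesis
        unfolding D_def by (auto intro!: derivative_eq_intros poly_DERIV)
    qed
    show "D (Suc d) x \<ge> 0" if x: "x > 0" for x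
    proof -
      have "\<bar>q powr x\<bar> < 1"
        using q x by (simp add: powr_def mult_pos_neg)
      hence "D (Suc d) x = (\<Sum>k. (-1) ^ Suc d * a (Suc d) k * (q powr x) ^ k)"
        unfolding D_Suc mult.assoc by (intro suminf_mult [symmetric] a)
      also have "\<dots> \<ge> 0"
      proof (rule suminf_nonneg)
        show "summable (\<lambda>k. (-1) ^ Suc d * a (Suc d) k * (q powr x) ^ k)"
          unfolding mult.assoc by (intro summable_mult a) fact
        show "0 \<le> (-1) ^ Suc d * a (Suc d) k * (q powr x) ^ k" for k
          by (intro mult_nonneg_nonneg sign) simp
      qed
      finally show ?thesis .
    qed
    show "(\<lambda>n. D (Suc d) (x + real n)) \<longlonglongrightarrow> 0" for x
      unfolding D_Suc by (intro tendsto_mult_right_zero exponential_series_tendsto_0 a q) (simp_all add: a_def)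
  qed
qed

section \<open>An identity theorem for meromorphic functions\<close>

lemma eventually_at_of_real:
  assumes "eventually P (at (of_real x :: complex))"
  shows "eventually (\<lambda>t. P (of_real t)) (at x)"
proof -
  have "filterlim (of_real :: real \<Rightarrow> complex) (at (of_real x)) (at x)"
    by (auto simp: filterlim_at eventually_at_filter intro!: tendsto_intros)
  with assms show ?thesis
    unfolding filterlim_iff by blast
qed

text \<open>
  The identity theorem on a connected domain, started from equality along the real axis near \<open>x\<close>.
  Equality holds first outside a sparse set; the normalisation at the poles then removes the exceptions.
\<close>
lemma nicely_meromorphic_eqI:
  assumes f: "f nicely_meromorphic_on A" and g: "g nicely_meromorphic_on A"
    and A: "open A" "connected A" and x: "of_real x \<in> A"
    and eq: "eventually (\<lambda>t. f (of_real t) = g (of_real t)) (at x)" and z: "z \<in> A"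
  shows "f z = g z"
proof -
  have "(\<forall>\<^sub>\<approx>w\<in>A. f w - g w = 0) \<or> (\<forall>\<^sub>\<approx>w\<in>A. f w - g w \<noteq> 0)"
    using f g by (intro meromorphic_imp_constant_or_avoid A meromorphic_intros)
      (auto simp: nicely_meromorphic_on_def)
  moreover have "\<not>(\<forall>\<^sub>\<approx>w\<in>A. f w - g w \<noteq> 0)"
  proof
    assume "\<forall>\<^sub>\<approx>w\<in>A. f w - g w \<noteq> 0"
    hence "eventually (\<lambda>w. f w - g w \<noteq> 0) (at (of_real x))"
      using x A by (simp add: eventually_cosparse_open_eq)
    from eventually_at_of_real[OF this] eq have "eventually (\<lambda>t. False) (at x)"
      by eventually_elim auto
    thus False by simp
  qed
  ultimately have ev: "eventually (\<lambda>w. f w = g w) (at z)"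
    using z A by (auto simp: eventually_cosparse_open_eq)
  have "is_pole f z \<longleftrightarrow> is_pole g z"
    using ev by (intro is_pole_cong) auto
  moreover have "f \<midarrow>z\<rightarrow> c \<longleftrightarrow> g \<midarrow>z\<rightarrow> c" for c
    using ev by (rule tendsto_cong)
  moreover have "(is_pole f z \<and> f z = 0) \<or> f \<midarrow>z\<rightarrow> f z" "(is_pole g z \<and> g z = 0) \<or> g \<midarrow>z\<rightarrow> g z"
    using f g z by (auto simp: nicely_meromorphic_on_def)
  moreover have "\<not>(is_pole f z \<and> f \<midarrow>z\<rightarrow> c)" for c
    unfolding is_pole_def using not_tendsto_and_filterlim_at_infinity[of "at z" f c] by auto
  ultimately show ?thesis
    by (metis LIM_unique)
qed

section \<open>Existence and uniqueness of the hierarchy\<close>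

lemma multigamma_product_hierarchy:
  assumes q: "0 < q" "q < 1"
  shows "q_multigamma_hierarchy q (multigamma_product (of_real q))"
  unfolding q_multigamma_hierarchy_def
proof (intro conjI allI impI)
  have q': "norm (of_real q :: complex) < 1" "of_real q \<noteq> (0 :: complex)"
      "of_real q \<in> ball 0 1 - (\<real>\<^sub>\<le>\<^sub>0 :: complex set)"
    using q by (auto simp: complex_nonpos_Reals_iff)
  show "multigamma_product (of_real q) d nicely_meromorphic_on UNIV" for d
    using nicely_meromorphic_multigamma_productI(1)[of UNIV "\<lambda>_. of_real q" "\<lambda>z. z" d] q'
    by simp
  show "multigamma_product (of_real q) d 1 = 1" for d
    using q' by (intro multigamma_product_1)
  show "multigamma_product (of_real q) 0 z = (1 - of_real q powr z) / (1 - of_real q)" for z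
    using q' by (intro multigamma_product_0)
  show "\<forall>\<^sub>\<approx>z\<in>UNIV. multigamma_product (of_real q) d (z + 1) =
          multigamma_product (of_real q) (d - 1) z * multigamma_product (of_real q) d z"
    if d: "d \<ge> 1" for d
  proof -
    obtain e where d: "d = Suc e"
      using d by (cases d) simp_all
    \<comment> \<open>The equation can only fail at the zeros of \<open>h\<close>, which form a sparse set since \<open>h 1 \<noteq> 0\<close>.\<close>
    define h where "h z = q_multifactorial (of_real q powr z) (of_real q) e" for z
    have "(\<lambda>z. of_real q powr z :: complex) holomorphic_on UNIV"
      using q by (auto intro!: holomorphic_on_powr_right holomorphic_intros)
    hence "h holomorphic_on UNIV"
      unfolding h_def using q' by (intro holomorphic_q_multifactorial) auto
    hence "h nicely_meromorphic_on UNIV"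
      by (intro analytic_on_imp_nicely_meromorphic_on) (simp add: analytic_on_open)
    moreover have "h 1 \<noteq> 0"
      using q' by (simp add: h_def q_multifactorial_eq_exp)
    ultimately have "\<forall>\<^sub>\<approx>z\<in>UNIV. h z \<noteq> 0"
      using nicely_meromorphic_imp_constant_or_avoid[of h UNIV 0] by auto
    thus ?thesis
      by eventually_elim
         (use q' in \<open>auto simp: d h_def intro!: multigamma_product_functional_equation\<close>)
  qed
  fix d :: nat and x :: real assume x: "x > 0"
  obtain p where p: "\<And>x. x > 0 \<Longrightarrow> multigamma_product (of_real q) d (of_real x) =
       of_real (exp (poly p x + (-1) ^ Suc d * (\<Sum>k. log_multifactorial_coeff q d k * (q powr x) ^ k)))"
    using multigamma_product_of_real[OF q, where d = d] by metis
  show "multigamma_product (of_real q) d (of_real x) \<in> \<real>"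
       "Re (multigamma_product (of_real q) d (of_real x)) > 0"
    unfolding p[OF x] by (auto simp del: of_real_exp)
  obtain D where D:
    "\<And>x. x > 0 \<Longrightarrow> ln (Re (multigamma_product (of_real q) d (of_real x))) = D 0 x"
    "\<And>n x. x > 0 \<Longrightarrow> (D n has_real_derivative D (Suc n) x) (at x)"
    "\<And>x. x > 0 \<Longrightarrow> D (Suc d) x \<ge> 0"
    using log_multigamma_product_derivatives[OF q, where d = d] by metis
  show "(deriv ^^ (d + 1)) (\<lambda>t. ln (Re (multigamma_product (of_real q) d (of_real t)))) x \<ge> 0"
    using nth_deriv_eqI[of "\<lambda>t. ln (Re (multigamma_product (of_real q) d (of_real t)))" D x "d + 1"] D x
    by simp
qed

text \<open>
  The real logarithm is the restriction of the branch \<open>Ln (f z)\<close>, which is holomorphic near the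
  positive half-axis, so its derivatives of all orders exist.
\<close>
lemma log_derivatives_of_positive_analytic:
  fixes f :: "complex \<Rightarrow> complex"
  assumes f: "\<And>x. x > 0 \<Longrightarrow> f analytic_on {of_real x}"
    and pos: "\<And>x. x > 0 \<Longrightarrow> f (of_real x) \<in> \<real> \<and> Re (f (of_real x)) > 0"
  obtains D :: "nat \<Rightarrow> real \<Rightarrow> real" where
    "\<And>x. x > 0 \<Longrightarrow> ln (Re (f (of_real x))) = D 0 x"
    "\<And>n x. x > 0 \<Longrightarrow> (D n has_real_derivative D (Suc n) x) (at x)"
proof -
  define W0 where "W0 = {z. f analytic_on {z}}"
  have "open W0"
  proof (subst open_subopen, safe)
    fix z assume "z \<in> W0"
    then obtain T where "open T" "z \<in> T" "f holomorphic_on T"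
      by (auto simp: W0_def analytic_at)
    thus "\<exists>T. open T \<and> z \<in> T \<and> T \<subseteq> W0"
      by (auto simp: W0_def analytic_at)
  qed
  have hol: "f holomorphic_on W0"
    unfolding W0_def by (intro analytic_imp_holomorphic) (subst analytic_on_analytic_at, auto)
  \<comment> \<open>On \<open>W\<close> the values of \<open>f\<close> avoid the branch cut of the logarithm.\<close>
  define W where "W = W0 \<inter> f -` (- \<real>\<^sub>\<le>\<^sub>0)"
  have W: "open W"
    unfolding W_def using \<open>open W0\<close> hol
    by (intro continuous_open_preimage holomorphic_on_imp_continuous_on) (auto simp: closed_def [symmetric])
  define \<Phi> where "\<Phi> z = Ln (f z)" for z
  have "\<Phi> holomorphic_on W"
    unfolding \<Phi>_def by (intro holomorphic_intros holomorphic_on_subset[OF hol]) (auto simp: W_def)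
  hence hd: "(deriv ^^ n) \<Phi> holomorphic_on W" for n
    using W by (rule holomorphic_higher_deriv)
  have xW: "of_real x \<in> W" if "x > 0" for x
    using f[OF that] pos[OF that] by (auto simp: W_def W0_def complex_nonpos_Reals_iff)
  show ?thesis
  proof (rule that[of "\<lambda>n t. Re ((deriv ^^ n) \<Phi> (of_real t))"])
    fix x :: real assume x: "x > 0"
    have "f (of_real x) = of_real (Re (f (of_real x)))"
      using pos[OF x] by (simp add: of_real_Re)
    thus "ln (Re (f (of_real x))) = Re ((deriv ^^ 0) \<Phi> (of_real x))"
      using Ln_of_real[of "Re (f (of_real x))"] pos[OF x] by (simp add: \<Phi>_def)
    fix n
    have "((deriv ^^ n) \<Phi> has_field_derivative (deriv ^^ Suc n) \<Phi> (of_real x)) (at (of_real x))"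
      using holomorphic_derivI[OF hd[of n] W xW[OF x]] by simp
    hence "((\<lambda>t. (deriv ^^ n) \<Phi> (of_real t)) has_vector_derivative (deriv ^^ Suc n) \<Phi> (of_real x)) (at x)"
      by (rule has_vector_derivative_real_field)
    from bounded_linear.has_vector_derivative[OF bounded_linear_Re this]
    show "((\<lambda>t. Re ((deriv ^^ n) \<Phi> (of_real t))) has_real_derivative Re ((deriv ^^ Suc n) \<Phi> (of_real x))) (at x)"
      by (simp add: has_real_derivative_iff_has_vector_derivative)
  qed
qed

text \<open>
  A pole is excluded because the value there would be 0, which is not positive.
\<close>
lemma q_multigamma_hierarchy_analytic:
  assumes "q_multigamma_hierarchy q G" "x > 0"
  shows "G d analytic_on {of_real x}"
proof (rule meromorphic_at_isCont_imp_analytic)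
  have "Re (G d (of_real x)) > 0"
    using assms by (simp add: q_multigamma_hierarchy_def)
  hence "G d (of_real x) \<noteq> 0"
    by auto
  moreover have "G d nicely_meromorphic_on {of_real x}"
    using assms by (auto simp: q_multigamma_hierarchy_def intro: nicely_meromorphic_on_subset)
  ultimately show "G d meromorphic_on {of_real x}" "isCont (G d) (of_real x)"
    by (auto simp: nicely_meromorphic_on_def isCont_def)
qed

text \<open>
  On the positive half-axis both sides are continuous, so the functional equation has no exceptions
  there.
\<close>
lemma q_multigamma_hierarchy_functional_equation:
  assumes G: "q_multigamma_hierarchy q G" and x: "x > 0"
  shows "G (Suc d) (of_real (x + 1)) = G d (of_real x) * G (Suc d) (of_real x)"
proof -
  have cont: "isCont (G e) (of_real y)" if "y > 0" for e y
    using q_multigamma_hierarchy_analytic[OF G that] by (rule analytic_at_imp_isCont)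
  have "\<forall>\<^sub>\<approx>z\<in>UNIV. G (Suc d) (z + 1) = G d z * G (Suc d) z"
    using G unfolding q_multigamma_hierarchy_def by (metis One_nat_def Suc_le_eq diff_Suc_1 zero_less_Suc)
  hence ev: "eventually (\<lambda>z. G d z * G (Suc d) z = G (Suc d) (z + 1)) (at (of_real x))"
    by (simp add: eventually_cosparse_open_eq eq_commute)
  have "(\<lambda>z. G (Suc d) (z + 1)) \<midarrow>of_real x\<rightarrow> G (Suc d) (of_real (x + 1))"
    using cont[of "x + 1" "Suc d"] x
    by (intro isCont_tendsto_compose[of _ "G (Suc d)"] tendsto_eq_intros) auto
  moreover have "(\<lambda>z. G d z * G (Suc d) z) \<midarrow>of_real x\<rightarrow> G d (of_real x) * G (Suc d) (of_real x)"
    using cont[OF x] by (intro tendsto_intros) (auto simp: isCont_def)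
  hence "(\<lambda>z. G (Suc d) (z + 1)) \<midarrow>of_real x\<rightarrow> G d (of_real x) * G (Suc d) (of_real x)"
    using ev by (rule Lim_transform_eventually)
  ultimately show ?thesis by (rule LIM_unique)
qed

text \<open>
  Induction on the level. At level \<open>d + 1\<close>, \<open>D\<close> is the sequence of derivatives of the difference of
  the logarithms of the two solutions; it is periodic by the functional equation and the induction
  hypothesis.
\<close>
lemma q_multigamma_hierarchy_unique:
  assumes q: "0 < q" "q < 1" and G: "q_multigamma_hierarchy q G"
  shows "G d = multigamma_product (of_real q) d"
proof (induction d)
  case 0
  show ?case
    using G multigamma_product_hierarchy[OF q] by (auto simp: q_multigamma_hierarchy_def)
next
  case (Suc d)
  define F where "F = multigamma_product (of_real q)"
  have F: "q_multigamma_hierarchy q F"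
    unfolding F_def by (rule multigamma_product_hierarchy[OF q])
  have pos: "H e (of_real x) \<in> \<real>" "Re (H e (of_real x)) > 0"
    if "q_multigamma_hierarchy q H" "x > 0" for H e x
    using that by (auto simp: q_multigamma_hierarchy_def)
  have feq: "ln (Re (H (Suc d) (of_real (x + 1)))) = ln (Re (H d (of_real x))) + ln (Re (H (Suc d) (of_real x)))"
    if H: "q_multigamma_hierarchy q H" and x: "x > 0" for H x
  proof -
    have "Re (H (Suc d) (of_real (x + 1))) = Re (H d (of_real x)) * Re (H (Suc d) (of_real x))"
      unfolding q_multigamma_hierarchy_functional_equation[OF H x]
      using pos(1)[OF H x, of d] by (auto elim!: Reals_cases)
    thus ?thesis
      using pos(2)[OF H x, of d] pos(2)[OF H x, of "Suc d"] by (simp add: ln_mult)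
  qed
  obtain A where A: "\<And>x. x > 0 \<Longrightarrow> ln (Re (G (Suc d) (of_real x))) = A 0 x"
    "\<And>n x. x > 0 \<Longrightarrow> (A n has_real_derivative A (Suc n) x) (at x)"
    using log_derivatives_of_positive_analytic[of "G (Suc d)"]
      q_multigamma_hierarchy_analytic[OF G, where d = "Suc d"] pos[OF G, where e = "Suc d"] by metis
  have A_nonneg: "A (Suc (Suc d)) x \<ge> 0" if "x > 0" for x
  proof -
    have "(deriv ^^ Suc (Suc d)) (\<lambda>t. ln (Re (G (Suc d) (of_real t)))) x = A (Suc (Suc d)) x"
      using A that by (intro nth_deriv_eqI)
    thus ?thesis
      using G that unfolding q_multigamma_hierarchy_def by (metis Suc_eq_plus1)
  qed
  obtain B where B: "\<And>x. x > 0 \<Longrightarrow> ln (Re (F (Suc d) (of_real x))) = B 0 x"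
    "\<And>n x. x > 0 \<Longrightarrow> (B n has_real_derivative B (Suc n) x) (at x)"
    "\<And>x. (\<lambda>n. B (Suc (Suc d)) (x + real n)) \<longlonglongrightarrow> 0"
    unfolding F_def using log_multigamma_product_derivatives[OF q, where d = "Suc d"] by metis
  define D where "D n x = A n x - B n x" for n x
  have D: "(D n has_real_derivative D (Suc n) x) (at x)" if "x > 0" for n x
    unfolding D_def using A B that by (auto intro!: derivative_intros)
  have per: "D 0 (x + 1) = D 0 x" if "x > 0" for x
    using A(1)[of x] A(1)[of "x + 1"] B(1)[of x] B(1)[of "x + 1"] feq[OF G that] feq[OF F that] that Suc
    by (simp add: D_def F_def)
  \<comment> \<open>By periodicity it suffices to look far to the right, where the contribution of \<open>B\<close> fades.\<close>
  have sign: "D (Suc (Suc d)) x \<ge> 0" if x: "x > 0" for x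
  proof -
    have "- B (Suc (Suc d)) (x + real k) \<le> D (Suc (Suc d)) x" for k
      using derivatives_of_periodic[of D x "Suc (Suc d)" k, OF D per x] A_nonneg[of "x + real k"] x
      by (simp add: D_def)
    thus ?thesis
      using tendsto_minus[OF B(3)[of x]] by (intro LIMSEQ_le_const2[of _ 0]) auto
  qed
  have eq: "G (Suc d) (of_real x) = F (Suc d) (of_real x)" if x: "x > 0" for x
  proof -
    have "D 0 x = D 0 1"
      by (rule periodic_with_signed_derivative_constant[of D, OF D per sign x]) auto
    also have "D 0 1 = 0"
      using A(1)[of 1] B(1)[of 1] G F by (simp add: D_def q_multigamma_hierarchy_def)
    finally have "ln (Re (G (Suc d) (of_real x))) = ln (Re (F (Suc d) (of_real x)))"
      using A(1)[OF x] B(1)[OF x] by (simp add: D_def)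
    thus ?thesis
      using pos[OF G x, of "Suc d"] pos[OF F x, of "Suc d"]
      by (simp add: complex_eq_iff complex_is_Real_iff)
  qed
  show ?case
  proof
    fix z
    have "eventually (\<lambda>t::real. t > 0) (at 1)"
      by (rule order_tendstoD(1)[OF tendsto_ident_at]) simp
    hence "eventually (\<lambda>t. G (Suc d) (of_real t) = F (Suc d) (of_real t)) (at 1)"
      by eventually_elim (rule eq)
    thus "G (Suc d) z = multigamma_product (of_real q) (Suc d) z"
      unfolding F_def
      by (rule nicely_meromorphic_eqI[where A = UNIV, rotated 5])
         (use G F in \<open>auto simp: q_multigamma_hierarchy_def F_def\<close>)
  qed
qed

lemma q_multigamma_real_eq:
  assumes "0 < q" "q < 1"
  shows "q_multigamma_real q = multigamma_product (of_real q)"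
  unfolding q_multigamma_real_def
  by (rule the_equality) (auto intro!: multigamma_product_hierarchy q_multigamma_hierarchy_unique assms)

section \<open>Continuation in the base\<close>

text \<open>
  The slit disc is star-shaped about 1/2: a segment from 1/2 to a point of the slit disc can
  meet the real axis only in positive reals.
\<close>
lemma open_connected_slit_disc:
  "open (ball 0 1 - \<real>\<^sub>\<le>\<^sub>0 :: complex set)" "connected (ball 0 1 - \<real>\<^sub>\<le>\<^sub>0 :: complex set)"
proof -
  show "open (ball 0 1 - \<real>\<^sub>\<le>\<^sub>0 :: complex set)"
    by (intro open_Diff) auto
  have "starlike (ball 0 1 - \<real>\<^sub>\<le>\<^sub>0 :: complex set)"
    unfolding starlike_def
  proof (intro bexI ballI)
    fix z :: complex assume z: "z \<in> ball 0 1 - \<real>\<^sub>\<le>\<^sub>0"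
    have "closed_segment (1/2) z \<subseteq> ball 0 1"
      using z by (intro closed_segment_subset) auto
    moreover have "w \<notin> \<real>\<^sub>\<le>\<^sub>0" if w: "w \<in> closed_segment (1/2) z" for w
    proof
      assume "w \<in> \<real>\<^sub>\<le>\<^sub>0"
      obtain u where u: "0 \<le> u" "u \<le> 1" "w = (1 - u) *\<^sub>R (1/2) + u *\<^sub>R z"
        using w by (auto simp: in_segment)
      have "u * Im z = 0" "(1 - u) / 2 + u * Re z \<le> 0"
        using \<open>w \<in> \<real>\<^sub>\<le>\<^sub>0\<close> u(3) by (auto simp: complex_nonpos_Reals_iff)
      moreover from this have "u \<noteq> 0"
        by auto
      moreover have "(1 - u) / 2 \<ge> 0"
        using u by simp
      ultimately have "Im z = 0" "u * Re z \<le> 0"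
        by (simp, linarith)
      thus False
        using z u \<open>u \<noteq> 0\<close> by (auto simp: complex_nonpos_Reals_iff mult_le_0_iff)
    qed
    ultimately show "closed_segment (1/2) z \<subseteq> ball 0 1 - \<real>\<^sub>\<le>\<^sub>0"
      by blast
  qed (auto simp: complex_nonpos_Reals_iff)
  thus "connected (ball 0 1 - \<real>\<^sub>\<le>\<^sub>0 :: complex set)"
    by (rule starlike_imp_connected)
qed

text \<open>
  Existence and uniqueness of the continuation in \<open>q\<close>; the point 1/2 serves as the base point of the
  identity theorem.
\<close>
lemma q_multigamma_eq:
  assumes q: "q \<in> ball 0 1 - \<real>\<^sub>\<le>\<^sub>0"
  shows "q_multigamma q d z = multigamma_product q d z"
  unfolding q_multigamma_def
proof (rule the_equality)
  show "\<exists>f. f nicely_meromorphic_on ball 0 1 - \<real>\<^sub>\<le>\<^sub>0 \<and>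
            (\<forall>x::real. 0 < x \<and> x < 1 \<longrightarrow> f (of_real x) = q_multigamma_real x d z) \<and>
            f q = multigamma_product q d z"
    by (intro exI[of _ "\<lambda>q. multigamma_product q d z"] conjI)
       (auto simp: q_multigamma_real_eq intro!: nicely_meromorphic_multigamma_productI(1) open_connected_slit_disc)
next
  fix w
  assume "\<exists>f. f nicely_meromorphic_on ball 0 1 - \<real>\<^sub>\<le>\<^sub>0 \<and>
            (\<forall>x::real. 0 < x \<and> x < 1 \<longrightarrow> f (of_real x) = q_multigamma_real x d z) \<and> f q = w"
  then obtain f where f: "f nicely_meromorphic_on ball 0 1 - \<real>\<^sub>\<le>\<^sub>0"
    "\<And>x::real. 0 < x \<Longrightarrow> x < 1 \<Longrightarrow> f (of_real x) = q_multigamma_real x d z" "f q = w"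
    by blast
  have "eventually (\<lambda>t::real. t \<in> {0<..<1}) (at (1/2))"
    by (intro eventually_at_in_open') auto
  hence "eventually (\<lambda>t. f (of_real t) = multigamma_product (of_real t) d z) (at (1/2))"
    by eventually_elim (simp add: f(2) q_multigamma_real_eq)
  hence "f q = multigamma_product q d z"
    by (rule nicely_meromorphic_eqI[where A = "ball 0 1 - \<real>\<^sub>\<le>\<^sub>0", rotated 5])
       (use q f(1) open_connected_slit_disc in
         \<open>auto intro!: nicely_meromorphic_multigamma_productI(1) simp: complex_nonpos_Reals_iff\<close>)
  thus "w = multigamma_product q d z"
    using f by simp
qed

theorem theorem4:
  fixes q :: complex and d :: nat
  assumes "q \<in> ball 0 1 - \<real>\<^sub>\<le>\<^sub>0"
  shows "q_multigamma q d nicely_meromorphic_on UNIV \<and>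
    (even d \<longrightarrow> q_multigamma q d holomorphic_on UNIV) \<and>
    (odd d \<longrightarrow> (\<lambda>z. 1 / q_multigamma q d z) holomorphic_on UNIV) \<and>
    (\<forall>z. q_multigamma q d (z + 1) =
       (\<Prod>i=0..d. q_multifactorial_powr q q i ((-1) ^ (i + 1) * (z gchoose (d - i)))) *
       q_multifactorial (q powr (z + 1)) q d powi ((-1) ^ d)) \<and>
    (\<forall>z. quantum_gamma q (z + 1) =
       1 / q_multifactorial_powr q q 0 z * q_multifactorial q q 1 *
       (1 / q_multifactorial (q powr (z + 1)) q 1)) \<and>
    (\<forall>z. quantum_Barnes q (z + 1) =
       1 / q_multifactorial_powr q q 0 (z * (z - 1) / 2) * q_multifactorial_powr q q 1 z *
       (1 / q_multifactorial q q 2) * q_multifactorial (q powr (z + 1)) q 2)"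
proof -
  have q: "norm q < 1" using assms by simp
  have eq: "q_multigamma q d = multigamma_product q d" for d
    using q_multigamma_eq[OF assms] by blast
  note mero = nicely_meromorphic_multigamma_productI[of UNIV "\<lambda>_. q" "\<lambda>z. z" d]
  note powr = q_multifactorial_powr_eq_exp[OF q q]
  have product: "multigamma_product q d (z + 1) =
       (\<Prod>i=0..d. q_multifactorial_powr q q i ((-1) ^ (i + 1) * (z gchoose (d - i)))) *
       q_multifactorial (q powr (z + 1)) q d powi ((-1) ^ d)" for z d
    by (simp only: multigamma_product_def log_prefactor_def powr exp_sum finite_atLeastAtMost add_diff_cancel_right')
  have gamma: "multigamma_product q 1 (z + 1) =
       1 / q_multifactorial_powr q q 0 z * q_multifactorial q q 1 *
       (1 / q_multifactorial (q powr (z + 1)) q 1)" for z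
    unfolding product powr q_multifactorial_eq_exp[OF q q]
    by (simp add: exp_minus inverse_eq_divide)
  have Barnes: "multigamma_product q 2 (z + 1) =
       1 / q_multifactorial_powr q q 0 (z * (z - 1) / 2) * q_multifactorial_powr q q 1 z *
       (1 / q_multifactorial q q 2) * q_multifactorial (q powr (z + 1)) q 2" for z
    unfolding product powr q_multifactorial_eq_exp[OF q q]
    by (simp add: numeral_2_eq_2 gbinomial_prod_rev exp_minus inverse_eq_divide)
  show ?thesis
    unfolding quantum_gamma_def quantum_Barnes_def eq
    using mero product gamma Barnes assms by auto
qed

end
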